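(* Fix a bounded sequence $\overline m=(m_0,m_1,\dots)$ of integers $m_i\ge 2$. There exists a constant $C>0$, depending only on $\sup\overline m$, such that the following holds. For any $0<s<t$ the effective resistance in $\mathcal G_{d,\overline m}$ satisfies \[ \operatorname{Res}\big(\hat\pi^{-1}[0,2^s),\,\hat\pi^{-1}[2^t,\infty)\big)\ \ge\ \begin{cases} C(t-s) & \text{for } d=1,\\ C(\log t-\log s) & \text{for } d=2.\end{cases} \]
   Context: Let $\overline m=(m_0,m_1,\dots)$ be a bounded sequence of integers $m_i\ge2$. $T_{\overline m}$ is the rooted spherically symmetric tree in which each vertex at level $i$ has $m_i$ children. Its ends are encoded by infinite sequences $x=\dots x_2x_1x_0$ with $x_i\in\{0,1,\dots,m_i-1\}$. $\mathcal E_0$ is the set of ends with only finitely many nonzero digits. For an end $x$ let $\ell_{-1}(x)=-1$ and $\ell_t(x)=\inf\{n>\ell_{t-1}(x): x_n\ne 0\}$. The mother group $\mathcal M_{d,\overline m}$ of degree $d$ is generated by automorphisms specified by $t\in\{-1,0,\dots,d\}$ and a sequence $(\sigma_i)_{i\le\max\overline m}$ with $\sigma_i\in S_i$ a permutation of $\{0,\dots,i-1\}$: with $k=1+\ell_t(x)$, the generator applies $\sigma_{m_k}$ to the digit $x_k$ of $x$ and leaves all other digits unchanged (if $k=\infty$, $x$ is fixed). $\mathcal G_{d,\overline m}$ is the Schreier graph of the action of $\mathcal M_{d,\overline m}$ on $\mathcal E_0$ with these generators (vertex set $\mathcal E_0$, an edge $(x,x\sigma)$ for each $x$ and each generator $\sigma$).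 Explicitly, distinct $x,y\in\mathcal E_0$ are adjacent if and only if they differ in exactly one coordinate $k$ and either $k=0$, or $k>0$, $x_{k-1}=y_{k-1}\neq0$ and the number of indices $i<k-1$ with $x_i\ne0$ is at most $d$. The graph is regarded as an electrical network in which each edge has unit conductance, and $\operatorname{Res}(A,B)$ denotes effective resistance between vertex sets $A$ and $B$. The map $\hat\pi:\mathcal E_0\to\mathbb N=\{0,1,2,\dots\}$ is defined as follows. For $x\in\mathcal E_0$ let $\pi(x)$ be the $\{0,1\}$-sequence with $\pi(x)_i=1$ iff $x_i\ne0$. For a $\{0,1\}$-sequence $u$ with finitely many ones, let $\hat u_k=\sum_{i\ge k}u_i \pmod 2$, and identify $\hat u$ with the integer $\sum_k\hat u_k2^k$. Then $\hat\pi(x)=\widehat{\pi(x)}$. *)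

theory Defs
  imports "HOL-Analysis.Analysis" "HOL-Combinatorics.Permutations" "HOL-Library.Extended_Nat"
begin

subsection \<open>Ends of the tree and the mother group\<close>

text \<open>An end \<open>\<dots>x\<^sub>2x\<^sub>1x\<^sub>0\<close> is the digit function \<open>i \<mapsto> x\<^sub>i\<close>.\<close>

definition ends0 :: "(nat \<Rightarrow> nat) \<Rightarrow> (nat \<Rightarrow> nat) set" where
  "ends0 m = {x. (\<forall>i. x i < m i) \<and> finite {i. x i \<noteq> 0}}"

text \<open>
  \<open>pos t x\<close> is \<open>1 + \<ell>\<^bsub>t-1\<^esub>(x)\<close>: the index \<open>t \<in> {-1,0,\<dots>,d}\<close> of a generator is shifted by one
  so as to be a natural number. The condition \<open>n > \<ell>\<^bsub>t-1\<^esub>(x)\<close> reads \<open>n \<ge> pos t x\<close>,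
  and the infimum of the empty set is \<open>\<infinity>\<close>.
\<close>

primrec pos :: "nat \<Rightarrow> (nat \<Rightarrow> nat) \<Rightarrow> enat" where
  "pos 0 x = 0"
| "pos (Suc t) x = eSuc (Inf {enat n | n. pos t x \<le> enat n \<and> x n \<noteq> 0})"

definition gen :: "(nat \<Rightarrow> nat) \<Rightarrow> nat \<Rightarrow> (nat \<Rightarrow> nat \<Rightarrow> nat) \<Rightarrow> (nat \<Rightarrow> nat) \<Rightarrow> (nat \<Rightarrow> nat)" where
  "gen m t \<sigma> x = (case pos t x of enat k \<Rightarrow> x(k := \<sigma> (m k) (x k)) | \<infinity> \<Rightarrow> x)"

definition mother_generators :: "nat \<Rightarrow> (nat \<Rightarrow> nat) \<Rightarrow> ((nat \<Rightarrow> nat) \<Rightarrow> (nat \<Rightarrow> nat)) set" where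
  "mother_generators d m =
     {gen m t \<sigma> | t \<sigma>. t \<le> d + 1 \<and> (\<forall>i \<le> (SUP j. m j). \<sigma> i permutes {..<i})}"

text \<open>
  A graph is a vertex set together with a symmetric set of ordered pairs. Loops and the multiplicities
  with which different generators produce the same edge are discarded.
\<close>

definition schreier_edges :: "'a set \<Rightarrow> ('a \<Rightarrow> 'a) set \<Rightarrow> ('a \<times> 'a) set" where
  "schreier_edges V S =
     {(x, y). x \<in> V \<and> y \<in> V \<and> x \<noteq> y \<and> (\<exists>g\<in>S. y = g x \<or> x = g y)}"

definition mother_edges :: "nat \<Rightarrow> (nat \<Rightarrow> nat) \<Rightarrow> ((nat \<Rightarrow> nat) \<times> (nat \<Rightarrow> nat)) set" where
  "mother_edges d m = schreier_edges (ends0 m) (mother_generators d m)"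

lemma pos_Suc_eq_enat_iff:
  "pos (Suc t) x = enat k \<longleftrightarrow> k > 0 \<and> x (k - 1) \<noteq> 0 \<and> card {i. i < k - 1 \<and> x i \<noteq> 0} = t"
proof (induction t arbitrary: k)
  have Inf_iff: "Inf {enat n | n. P n} = enat k \<longleftrightarrow> P k \<and> (\<forall>i<k. \<not> P i)" for P k
  proof
    assume *: "Inf {enat n | n. P n} = enat k"
    have ne: "{enat n | n. P n} \<noteq> {}"
    proof
      assume e: "{enat n | n. P n} = {}"
      show False using * unfolding e by (simp add: Inf_enat_def)
    qed
    then obtain z where "z \<in> {enat n | n. P n}" by blast
    then have "Inf {enat n | n. P n} \<in> {enat n | n. P n}"
      unfolding Inf_enat_def if_not_P[OF ne] by (rule LeastI)
    moreover have "\<not> P i" if "i < k" for i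
    proof
      assume "P i"
      then have "Inf {enat n | n. P n} \<le> enat i" by (intro Inf_lower) auto
      with * that show False by simp
    qed
    ultimately show "P k \<and> (\<forall>i<k. \<not> P i)" using * by auto
  next
    assume *: "P k \<and> (\<forall>i<k. \<not> P i)"
    show "Inf {enat n | n. P n} = enat k"
    proof (rule antisym)
      show "Inf {enat n | n. P n} \<le> enat k" using * by (intro Inf_lower) auto
      show "enat k \<le> Inf {enat n | n. P n}" using * by (intro Inf_greatest) (auto simp: not_less[symmetric])
    qed
  qed
  have step: "pos (Suc t) x = enat k \<longleftrightarrow>
      k > 0 \<and> (pos t x \<le> enat (k - 1) \<and> x (k - 1) \<noteq> 0) \<and>
      (\<forall>i<k - 1. \<not> (pos t x \<le> enat i \<and> x i \<noteq> 0))" for t k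
  proof (cases k)
    case 0
    then show ?thesis by (simp add: zero_enat_def[symmetric])
  next
    case (Suc l)
    then show ?thesis
      by (simp only: pos.simps eSuc_enat[symmetric] eSuc_inject Inf_iff) simp
  qed
  {
    case 0
    show ?case by (subst step) auto
  next
    case (Suc t)
    show ?case
    proof
      assume "pos (Suc (Suc t)) x = enat k"
      then have k: "k > 0" "pos (Suc t) x \<le> enat (k - 1)" "x (k - 1) \<noteq> 0"
        and no: "\<And>i. i < k - 1 \<Longrightarrow> pos (Suc t) x \<le> enat i \<Longrightarrow> x i = 0"
        using step[of "Suc t" k] by blast+
      from k(2) obtain l where l: "pos (Suc t) x = enat l" "l \<le> k - 1"
        by (metis enat_ile enat_ord_simps(1))
      from l(1) have l': "l > 0" "x (l - 1) \<noteq> 0" "card {i. i < l - 1 \<and> x i \<noteq> 0} = t"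
        using Suc[of l] by blast+
      have "{i. i < k - 1 \<and> x i \<noteq> 0} = insert (l - 1) {i. i < l - 1 \<and> x i \<noteq> 0}"
        using l l' no by (force simp: not_le)
      then show "k > 0 \<and> x (k - 1) \<noteq> 0 \<and> card {i. i < k - 1 \<and> x i \<noteq> 0} = Suc t"
        using k l' by simp
    next
      assume *: "k > 0 \<and> x (k - 1) \<noteq> 0 \<and> card {i. i < k - 1 \<and> x i \<noteq> 0} = Suc t"
      define A where "A = {i. i < k - 1 \<and> x i \<noteq> 0}"
      have A: "finite A" "card A = Suc t" using * by (auto simp: A_def)
      then have "A \<noteq> {}" by auto
      note A = A this
      define a where "a = Max A"
      have a: "a \<in> A" "\<And>i. i \<in> A \<Longrightarrow> i \<le> a" using A by (auto simp: a_def)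
      have "{i. i < a \<and> x i \<noteq> 0} = A - {a}"
        using a by (force simp: A_def)
      then have "card {i. i < a \<and> x i \<noteq> 0} = t"
        using \<open>card A = Suc t\<close> a(1) A(1) by simp
      then have p: "pos (Suc t) x = enat (Suc a)"
        using Suc[of "Suc a"] a by (auto simp: A_def)
      show "pos (Suc (Suc t)) x = enat k"
        using * a by (subst step, unfold p) (fastforce simp: A_def)
    qed
  }
qed

text \<open>The explicit description of the Schreier graph.\<close>

lemma mother_edges_iff:
  assumes x: "x \<in> ends0 m" and y: "y \<in> ends0 m" and "x \<noteq> y"
  shows "(x, y) \<in> mother_edges d m \<longleftrightarrow>
    (\<exists>k. x k \<noteq> y k \<and> (\<forall>i. i \<noteq> k \<longrightarrow> x i = y i) \<and>
         (k = 0 \<or> x (k - 1) = y (k - 1) \<and> x (k - 1) \<noteq> 0 \<and>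
                  card {i. i < k - 1 \<and> x i \<noteq> 0} \<le> d))"
    (is "_ \<longleftrightarrow> (\<exists>k. ?R x y k)")
proof
  have R: "\<exists>k. ?R x y k"
    if xy: "x \<noteq> y" and g: "g \<in> mother_generators d m" "y = g x" for x y g
  proof -
    from g obtain t \<sigma> where t: "t \<le> d + 1" "y = gen m t \<sigma> x"
      unfolding mother_generators_def by auto
    with xy obtain k where k: "pos t x = enat k" "y = x(k := \<sigma> (m k) (x k))"
      by (auto simp: gen_def split: enat.splits)
    have "k = 0 \<or> k > 0 \<and> x (k - 1) \<noteq> 0 \<and> card {i. i < k - 1 \<and> x i \<noteq> 0} \<le> d"
    proof (cases t)
      case 0
      with k show ?thesis by (simp add: zero_enat_def)
    next
      case (Suc t')
      with k have "pos (Suc t') x = enat k" by simp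
      with Suc t show ?thesis by (subst (asm) pos_Suc_eq_enat_iff) auto
    qed
    with k xy have "?R x y k" by auto
    then show ?thesis ..
  qed
  have flip: "?R x y k" if *: "?R y x k" for k
  proof -
    have "{i. i < k - 1 \<and> x i \<noteq> 0} = {i. i < k - 1 \<and> y i \<noteq> 0}"
      by (rule Collect_cong) (metis * less_imp_diff_less less_irrefl less_le_trans diff_le_self)
    then have "card {i. i < k - 1 \<and> x i \<noteq> 0} = card {i. i < k - 1 \<and> y i \<noteq> 0}"
      by (rule arg_cong)
    moreover have "x (k - 1) = y (k - 1)" "x (k - 1) \<noteq> 0" if "k \<noteq> 0"
      using * that by fastforce+
    moreover have "x k \<noteq> y k" "\<forall>i. i \<noteq> k \<longrightarrow> x i = y i"
      using * by metis+
    ultimately show ?thesis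
      using conjunct2[OF conjunct2[OF *]] by presburger
  qed
  {
    assume "(x, y) \<in> mother_edges d m"
    then have "\<exists>g\<in>mother_generators d m. y = g x \<or> x = g y"
      unfolding mother_edges_def schreier_edges_def by blast
    then obtain g where g: "g \<in> mother_generators d m" "y = g x \<or> x = g y" by blast
    from g(2) show "\<exists>k. ?R x y k"
    proof
      assume "y = g x"
      from R[of x y g, OF \<open>x \<noteq> y\<close> g(1) this] show ?thesis .
    next
      assume "x = g y"
      from R[of y x g, OF \<open>x \<noteq> y\<close>[symmetric] g(1) this] obtain k where "?R y x k" by blast
      from flip[OF this] show ?thesis by blast
    qed
  next
    assume "\<exists>k. ?R x y k"
    then obtain k where k: "?R x y k" ..
    define \<sigma> where "\<sigma> = (\<lambda>i. if i = m k then Transposition.transpose (x k) (y k) else id)"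
    have "x k < m k" "y k < m k"
      using x y by (auto simp: ends0_def)
    have perm: "\<sigma> i permutes {..<i}" for i
    proof (cases "i = m k")
      case True
      then show ?thesis
        using permutes_swap_id[of "x k" "{..<i}" "y k"] \<open>x k < m k\<close> \<open>y k < m k\<close>
        by (simp add: \<sigma>_def)
    next
      case False
      then show ?thesis by (simp add: \<sigma>_def permutes_id)
    qed
    obtain t where t: "t \<le> d + 1" "pos t x = enat k"
    proof (cases "k = 0")
      case True
      then have "pos 0 x = enat k" by (simp add: zero_enat_def)
      then show thesis by (intro that[of 0]) simp_all
    next
      case False
      define c where "c = card {i. i < k - 1 \<and> x i \<noteq> 0}"
      have c: "c \<le> d" "x (k - 1) \<noteq> 0"
        using conjunct2[OF conjunct2[OF k]] False unfolding c_def by simp_all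
      from False c(2) have "pos (Suc c) x = enat k"
        unfolding pos_Suc_eq_enat_iff c_def by simp
      then show thesis using c by (intro that[of "Suc c"]) simp_all
    qed
    have "gen m t \<sigma> x = x(k := \<sigma> (m k) (x k))"
      by (simp add: gen_def t)
    also have "\<dots> = x(k := y k)" by (simp add: \<sigma>_def)
    also have "\<dots> = y"
    proof
      fix i show "(x(k := y k)) i = y i" using conjunct1[OF conjunct2[OF k]] by (cases "i = k") simp_all
    qed
    finally have yg: "y = gen m t \<sigma> x" by (rule sym)
    have "gen m t \<sigma> \<in> mother_generators d m"
      unfolding mother_generators_def using t(1) perm by blast
    then show "(x, y) \<in> mother_edges d m"
      using x y \<open>x \<noteq> y\<close> yg unfolding mother_edges_def schreier_edges_def by blast
  }
qed


subsection \<open>The map to the natural numbers\<close>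

definition pi01 :: "(nat \<Rightarrow> nat) \<Rightarrow> nat \<Rightarrow> nat" where
  "pi01 x i = (if x i \<noteq> 0 then 1 else 0)"

text \<open>
  The sums are restricted to the (finite) supports, since \<^const>\<open>sum\<close> vanishes on infinite index sets.
\<close>

definition hat :: "(nat \<Rightarrow> nat) \<Rightarrow> nat \<Rightarrow> nat" where
  "hat u k = (\<Sum>i | i \<ge> k \<and> u i \<noteq> 0. u i) mod 2"

definition binary_value :: "(nat \<Rightarrow> nat) \<Rightarrow> nat" where
  "binary_value u = (\<Sum>k | u k \<noteq> 0. u k * 2 ^ k)"

definition hatpi :: "(nat \<Rightarrow> nat) \<Rightarrow> nat" where
  "hatpi x = binary_value (hat (pi01 x))"


subsection \<open>Effective resistance\<close>

text \<open>
  Electrical network with unit conductances on a locally finite graph: \<open>A\<close> is held at potential 1,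
  \<open>B\<close> at potential 0, and Kirchhoff's node law holds at every other vertex.
  The effective resistance is the potential difference divided by the total current flowing out of \<open>A\<close>.
  Apart from locally finite graphs, the definition is meant for disjoint \<open>A\<close>, \<open>B\<close> with
  \<open>V - (A \<union> B)\<close> finite, so that identifying \<open>A\<close> and \<open>B\<close> to points gives a network on finitely
  many vertices; then a voltage exists, and although it need not be unique on components
  that meet neither \<open>A\<close> nor \<open>B\<close>, the current is unique. Zero current means resistance \<open>\<infinity>\<close>.
\<close>

definition voltage :: "'a set \<Rightarrow> ('a \<times> 'a) set \<Rightarrow> 'a set \<Rightarrow> 'a set \<Rightarrow> ('a \<Rightarrow> real) \<Rightarrow> bool" where
  "voltage V E A B v \<longleftrightarrow>
     (\<forall>x\<in>A. v x = 1) \<and> (\<forall>x\<in>B. v x = 0) \<and>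
     (\<forall>x\<in>V - (A \<union> B). (\<Sum>y | (x, y) \<in> E. v x - v y) = 0)"

definition current_out :: "('a \<times> 'a) set \<Rightarrow> 'a set \<Rightarrow> ('a \<Rightarrow> real) \<Rightarrow> real" where
  "current_out E A v = (\<Sum>\<^sub>\<infinity>x\<in>A. \<Sum>y | (x, y) \<in> E. v x - v y)"

definition eff_resistance :: "'a set \<Rightarrow> ('a \<times> 'a) set \<Rightarrow> 'a set \<Rightarrow> 'a set \<Rightarrow> ereal" where
  "eff_resistance V E A B =
     1 / ereal (THE I. \<exists>v. voltage V E A B v \<and> I = current_out E A v)"

definition mother_Res :: "nat \<Rightarrow> (nat \<Rightarrow> nat) \<Rightarrow> (nat \<Rightarrow> nat) set \<Rightarrow> (nat \<Rightarrow> nat) set \<Rightarrow> ereal" where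
  "mother_Res d m = eff_resistance (ends0 m) (mother_edges d m)"

end

theory Submission imports Defs begin

text \<open>
  By Dirichlet's principle the resistance between two sets is at least \<open>(b - a)\<^sup>2 / e\<close> for every function that
  equals \<open>a\<close> on one set and \<open>b\<close> on the other and has energy at most \<open>e\<close>; the whole task is to find a good
  function (\<open>dirichlet_lower_bound\<close>).

  In degree \<open>0\<close> the map \<open>hatpi\<close> collapses the graph to a path, because Gray code changes one digit at a time.
  Up to a bounded factor, the number of edges over the step from \<open>n\<close> to \<open>n + 1\<close> is the number of
  ends over \<open>n\<close>, that is, the product of the \<open>m\<^sub>i - 1\<close> over the positions \<open>i\<close> of the ones in the Gray code of \<open>n\<close>.
  Its reciprocal is the natural length of that step, and the accumulated length is a coordinate \<open>position\<close>
  on the ends. The ends without digits from \<open>n\<close> on occupy the segment from \<open>0\<close> to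
  \<open>mass n\<close>, the product of the \<open>m\<^sub>i / (m\<^sub>i - 1)\<close> with \<open>i < n\<close>, which grows geometrically.

  Degree \<open>d > 0\<close> adds long edges, but they do little harm. Switching digit \<open>k > 0\<close> on or off moves the coordinate by at most
  twice the coordinate of the first \<open>k - 1\<close> digits, divided by all the \<open>m\<^sub>i - 1\<close> belonging to higher
  nonzero digits. The edge exists only if at most \<open>d\<close> of the first \<open>k - 1\<close> digits are nonzero, and then
  that coordinate is typically tiny. Summing squares digit by digit shows that the edges between the ends
  supported on the first \<open>n\<close> digits contribute at most a constant times \<open>n\<^bsup>d - 1\<^esup> (mass n)\<^sup>2\<close> to
  the energy of \<open>position\<close> (\<open>sum_jumps_le\<close>).

  So for a function \<open>g\<close> of the coordinate, the edges near scale \<open>K\<close> contribute at most a constant times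
  \<open>K\<^bsup>d - 1\<^esup> (g' \<cdot> mass K)\<^sup>2\<close>, with \<open>g'\<close> taken near \<open>mass K\<close> (\<open>mother_Res_ge_of_potential\<close>). As \<open>ln (mass K)\<close> is comparable to \<open>K\<close>, taking
  \<open>g = ln\<close> for \<open>d = 1\<close> gives energy of order \<open>t - s\<close> and a potential difference of the same
  order; taking \<open>g = ln \<circ> ln\<close> for \<open>d = 2\<close> gives energy of order \<open>\<Sum>K=s..t. 1 / K\<close> and a
  potential difference of order \<open>ln t - ln s\<close>.
\<close>

section \<open>Dirichlet's principle for effective resistance\<close>

locale finite_network =
  fixes V :: "'a set" and E :: "('a \<times> 'a) set" and A B :: "'a set"
  assumes sym: "(x, y) \<in> E \<Longrightarrow> (y, x) \<in> E"
    and edges_in: "E \<subseteq> V \<times> V"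
    and finite_nbrs: "finite {y. (x, y) \<in> E}"
    and finite_rest: "finite (V - B)"
    and A_sub: "A \<subseteq> V - B"
    and B_sub: "B \<subseteq> V"
begin

definition net_flow :: "('a \<Rightarrow> real) \<Rightarrow> 'a \<Rightarrow> real" where
  "net_flow v x = (\<Sum>y | (x, y) \<in> E. v x - v y)"

text \<open>
  Arcs with both ends in \<open>B\<close> are left out so that only finitely many remain. Both orientations of an
  edge are present, so sums over arcs count each edge twice.
\<close>

definition arcs :: "('a \<times> 'a) set" where
  "arcs = {(x, y) \<in> E. x \<notin> B \<or> y \<notin> B}"

definition dirichlet :: "('a \<Rightarrow> real) \<Rightarrow> ('a \<Rightarrow> real) \<Rightarrow> real" where
  "dirichlet f v = (\<Sum>(x, y)\<in>arcs. (f x - f y) * (v x - v y))"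

lemma finite_arcs: "finite arcs"
proof -
  have "finite (Sigma (V - B) (\<lambda>x. {y. (x, y) \<in> E}))"
    using finite_rest finite_nbrs by (intro finite_SigmaI) auto
  moreover have "arcs \<subseteq> Sigma (V - B) (\<lambda>x. {y. (x, y) \<in> E})
      \<union> prod.swap ` Sigma (V - B) (\<lambda>x. {y. (x, y) \<in> E})"
    using edges_in sym by (force simp: arcs_def image_iff)
  ultimately show ?thesis by (meson finite_UnI finite_imageI finite_subset)
qed

lemma sum_arcs_swap: "(\<Sum>(x, y)\<in>arcs. h x y) = (\<Sum>(x, y)\<in>arcs. h y x)"
  for h :: "'a \<Rightarrow> 'a \<Rightarrow> real"
  by (rule sum.reindex_bij_witness[of _ prod.swap prod.swap]) (auto simp: arcs_def intro: sym)

lemma dirichlet_commute: "dirichlet f v = dirichlet v f"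
  by (simp add: dirichlet_def mult.commute)

text \<open>
  Summation by parts. The factor \<open>2\<close> comes from the two orientations of an edge.
\<close>

lemma green_identity:
  assumes f: "\<forall>x\<in>B. f x = 0"
  shows "dirichlet f v = 2 * (\<Sum>x\<in>V - B. f x * net_flow v x)"
proof -
  have "dirichlet f v = (\<Sum>(x, y)\<in>arcs. f x * (v x - v y)) + (\<Sum>(x, y)\<in>arcs. f y * (v y - v x))"
    unfolding dirichlet_def sum.distrib[symmetric] by (intro sum.cong) (auto simp: algebra_simps)
  also have "(\<Sum>(x, y)\<in>arcs. f y * (v y - v x)) = (\<Sum>(x, y)\<in>arcs. f x * (v x - v y))"
    by (rule sum_arcs_swap)
  also have "(\<Sum>(x, y)\<in>arcs. f x * (v x - v y))
      = (\<Sum>(x, y)\<in>Sigma (V - B) (\<lambda>x. {y. (x, y) \<in> E}). f x * (v x - v y))"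
    using finite_arcs edges_in f by (intro sum.mono_neutral_right) (auto simp: arcs_def)
  also have "\<dots> = (\<Sum>x\<in>V - B. f x * net_flow v x)"
    using finite_rest finite_nbrs by (subst sum.Sigma[symmetric]) (auto simp: net_flow_def sum_distrib_left)
  finally show ?thesis by simp
qed

text \<open>
  By Kirchhoff's law only the vertices of \<open>A\<close> contribute to Green's identity. Since \<open>f\<close> is free apart from its
  boundary values, it may be another voltage, and then the symmetry of the Dirichlet form shows that all
  voltages carry the same current.
\<close>

lemma current_eq_dirichlet:
  assumes v: "voltage V E A B v" and f: "\<forall>x\<in>A. f x = 1" "\<forall>x\<in>B. f x = 0"
  shows "current_out E A v = dirichlet f v / 2"
proof -
  have "finite A" using A_sub finite_rest finite_subset by blast
  then have "current_out E A v = (\<Sum>x\<in>A. f x * net_flow v x)"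
    using f by (simp add: current_out_def net_flow_def)
  also have "\<dots> = (\<Sum>x\<in>V - B. f x * net_flow v x)"
    using v A_sub finite_rest by (intro sum.mono_neutral_left) (auto simp: voltage_def net_flow_def)
  also have "\<dots> = dirichlet f v / 2" by (simp add: green_identity[OF f(2)])
  finally show ?thesis .
qed

lemma dirichlet_self_nonneg: "0 \<le> dirichlet f f"
  by (auto simp: dirichlet_def intro!: sum_nonneg)

lemma dirichlet_shift:
  "dirichlet (\<lambda>x. v x + c * h x) (\<lambda>x. v x + c * h x)
    = dirichlet v v + 2 * c * dirichlet h v + c\<^sup>2 * dirichlet h h"
  unfolding dirichlet_def sum_distrib_left sum.distrib[symmetric]
  by (intro sum.cong) (auto simp: power2_eq_square algebra_simps)

lemma current_unique:
  assumes "voltage V E A B v" "voltage V E A B v'"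
  shows "current_out E A v = current_out E A v'"
  using current_eq_dirichlet[OF assms(1), of v'] current_eq_dirichlet[OF assms(2), of v] assms
  by (simp add: voltage_def dirichlet_commute)

text \<open>
  A minimiser of the energy among functions with values between \<open>0\<close> and \<open>1\<close> exists by
  compactness. If Kirchhoff's law failed at a vertex, replacing the value there by the average over its neighbours
  would stay within these functions and strictly lower the energy. This
  argument also covers components that meet neither \<open>A\<close> nor \<open>B\<close>, which make the linear system singular.
\<close>

lemma ex_voltage: "\<exists>v. voltage V E A B v"
proof -
  define S :: "'a \<Rightarrow> real set" where
    "S x = (if x \<in> A then {1} else if x \<in> V - B then {0..1} else {0})" for x
  have S01: "S x \<subseteq> {0..1}" "S x \<noteq> {}" for x by (auto simp: S_def)
  have "compact (PiE UNIV S)"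
  proof -
    have "compactin (product_topology (\<lambda>i. euclidean) UNIV) (PiE UNIV S)"
      by (subst compactin_PiE) (auto simp: S_def)
    then show ?thesis by (simp add: euclidean_product_topology)
  qed
  moreover have "PiE UNIV S \<noteq> {}" using S01(2) by (simp add: PiE_eq_empty_iff)
  moreover have "continuous_on (PiE UNIV S) (\<lambda>v. dirichlet v v)"
    unfolding dirichlet_def case_prod_unfold
    by (intro continuous_intros continuous_on_subset[OF continuous_on_product_coordinates]) auto
  ultimately obtain v where v: "v \<in> PiE UNIV S"
    and min: "\<And>u. u \<in> PiE UNIV S \<Longrightarrow> dirichlet v v \<le> dirichlet u u"
    using continuous_attains_inf[of "PiE UNIV S" "\<lambda>v. dirichlet v v"] by blast
  have vS: "v x \<in> S x" for x using v by auto
  have flow: "net_flow v x = 0" if x: "x \<in> V - (A \<union> B)" for x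
  proof -
    define N where "N = {y. (x, y) \<in> E}"
    have N: "finite N" using finite_nbrs by (simp add: N_def)
    show ?thesis
    proof (cases "N = {}")
      case True
      then show ?thesis by (simp add: net_flow_def N_def)
    next
      case False
      define n where "n = real (card N)"
      have n: "n > 0" using False N by (simp add: n_def card_gt_0_iff)
      define h :: "'a \<Rightarrow> real" where "h y = (if y = x then 1 else 0)" for y
      \<comment> \<open>moving the value at \<open>x\<close> by \<open>c\<close> turns it into the average over the neighbours\<close>
      define c where "c = - net_flow v x / n"
      have flow_eq: "net_flow v x = n * v x - sum v N"
        by (simp add: net_flow_def N_def[symmetric] sum_subtractf n_def)
      have avg: "v x + c = sum v N / n" using n by (simp add: c_def flow_eq field_simps)
      have "0 \<le> sum v N" "sum v N \<le> n"
        using vS S01(1) by (force intro!: sum_nonneg, force simp: n_def intro!: sum_bounded_above[of N v 1, simplified])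
      then have "0 \<le> v x + c" "v x + c \<le> 1" using n by (auto simp: avg)
      then have "v y + c * h y \<in> S y" for y
        using vS[of y] x by (cases "y = x") (auto simp: h_def S_def)
      then have "(\<lambda>y. v y + c * h y) \<in> PiE UNIV S" by auto
      from min[OF this] have le: "0 \<le> 2 * c * dirichlet h v + c\<^sup>2 * dirichlet h h"
        by (simp add: dirichlet_shift)
      have hB: "\<forall>y\<in>B. h y = 0" using x by (auto simp: h_def)
      have single: "(\<Sum>y\<in>V - B. h y * g y) = g x" for g
      proof -
        have "(\<Sum>y\<in>V - B. h y * g y) = (\<Sum>y\<in>V - B. if y = x then g y else 0)"
          by (intro sum.cong) (auto simp: h_def)
        then show ?thesis using x finite_rest by simp
      qed
      have "net_flow h x \<le> n"
        using sum_bounded_above[of N "\<lambda>y. h x - h y" 1] by (simp add: net_flow_def N_def[symmetric] n_def h_def)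
      then have hh: "dirichlet h h \<le> 2 * n" by (simp add: green_identity[OF hB] single)
      have hv: "dirichlet h v = 2 * net_flow v x" by (simp add: green_identity[OF hB] single)
      have "0 \<le> 2 * c * (2 * net_flow v x) + c\<^sup>2 * (2 * n)"
        using le mult_left_mono[OF hh, of "c\<^sup>2"] hv by (simp add: algebra_simps)
      also have "\<dots> = - 2 * (net_flow v x)\<^sup>2 / n"
        using n by (simp add: c_def power2_eq_square field_simps)
      finally have "(net_flow v x)\<^sup>2 \<le> 0" using n by (simp add: field_simps)
      then show ?thesis by simp
    qed
  qed
  have "voltage V E A B v"
    unfolding voltage_def
  proof (intro conjI ballI)
    fix x
    show "v x = 1" if "x \<in> A" using vS[of x] that by (simp add: S_def)
    show "v x = 0" if "x \<in> B" using vS[of x] that A_sub by (auto simp: S_def split: if_splits)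
    show "(\<Sum>y | (x, y) \<in> E. v x - v y) = 0" if "x \<in> V - (A \<union> B)"
      using flow[OF that] by (simp add: net_flow_def)
  qed
  then show ?thesis by blast
qed

text \<open>
  After normalising \<open>f\<close> to boundary values \<open>1\<close> and \<open>0\<close>, the current is half the pairing of \<open>f\<close> with the
  voltage and also half the energy of the voltage; so positivity of the energy of their difference bounds
  the current by half the energy of \<open>f\<close>. The set \<open>P\<close> lists, in at least one orientation,
  the edges along which \<open>f\<close> varies. A vanishing current means infinite resistance, for which the bound is trivial.
\<close>

theorem dirichlet_lower_bound:
  assumes fA: "\<And>x. x \<in> A \<Longrightarrow> f x = a" and fB: "\<And>x. x \<in> B \<Longrightarrow> f x = b" and "a \<noteq> b"
    and P: "finite P" "\<And>x y. (x, y) \<in> E \<Longrightarrow> f x \<noteq> f y \<Longrightarrow> (x, y) \<in> P \<or> (y, x) \<in> P"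
    and energy: "(\<Sum>(x, y)\<in>P. (f x - f y)\<^sup>2) \<le> e"
  shows "ereal ((b - a)\<^sup>2 / e) \<le> eff_resistance V E A B"
proof -
  obtain v where v: "voltage V E A B v" using ex_voltage by blast
  define I where "I = current_out E A v"
  define h where "h x = (b - f x) / (b - a)" for x
  have h: "\<forall>x\<in>A. h x = 1" "\<forall>x\<in>B. h x = 0" using fA fB \<open>a \<noteq> b\<close> by (auto simp: h_def)
  have Ih: "I = dirichlet h v / 2" unfolding I_def by (rule current_eq_dirichlet[OF v h])
  have Iv: "I = dirichlet v v / 2"
    unfolding I_def using v by (intro current_eq_dirichlet[OF v]) (auto simp: voltage_def)
  have I0: "0 \<le> I" using dirichlet_self_nonneg[of v] by (simp add: Iv)
  \<comment> \<open>positivity of the energy of \<open>h - v\<close>\<close>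
  have "0 \<le> dirichlet h h - 2 * I"
    using dirichlet_self_nonneg[of "\<lambda>x. h x + (- 1) * v x"] Ih Iv
    unfolding dirichlet_shift by (simp add: dirichlet_commute)
  moreover have "dirichlet h h \<le> 2 * e / (b - a)\<^sup>2"
  proof -
    have arcs_le: "(\<Sum>(x, y)\<in>arcs. (f x - f y)\<^sup>2) \<le> 2 * e"
    proof -
      define g :: "'a \<times> 'a \<Rightarrow> real" where "g = (\<lambda>(x, y). (f x - f y)\<^sup>2)"
      have g0: "0 \<le> g p" for p by (simp add: g_def split_beta)
      have "sum g arcs = sum g {(x, y) \<in> arcs. f x \<noteq> f y}"
        using finite_arcs by (intro sum.mono_neutral_right) (auto simp: g_def)
      also have "\<dots> \<le> sum g (P \<union> prod.swap ` P)"
      proof (rule sum_mono2)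
        show "{(x, y) \<in> arcs. f x \<noteq> f y} \<subseteq> P \<union> prod.swap ` P"
        proof (rule subsetI, clarify)
          fix x y assume "(x, y) \<in> arcs" "f x \<noteq> f y" "(x, y) \<notin> prod.swap ` P"
          moreover from this have "(y, x) \<notin> P" by (metis image_eqI swap_simp)
          ultimately show "(x, y) \<in> P" using P(2)[of x y] by (simp add: arcs_def)
        qed
      qed (use P(1) g0 in auto)
      also have "\<dots> \<le> sum g P + sum g (prod.swap ` P)"
        using sum.union_inter[of P "prod.swap ` P" g] P(1) sum_nonneg[of "P \<inter> prod.swap ` P" g] g0 by simp
      also have "sum g (prod.swap ` P) = sum g P"
        by (subst sum.reindex) (auto simp: g_def power2_commute intro!: sum.cong)
      finally show ?thesis using energy by (simp add: g_def)
    qed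
    have "dirichlet h h = (\<Sum>(x, y)\<in>arcs. (f x - f y)\<^sup>2 / (b - a)\<^sup>2)"
    proof -
      have "(h x - h y) * (h x - h y) = (f x - f y)\<^sup>2 / (b - a)\<^sup>2" for x y
      proof -
        have "h x - h y = - (f x - f y) / (b - a)"
          by (simp add: h_def diff_divide_distrib[symmetric])
        then show ?thesis by (simp add: power2_eq_square) (simp add: algebra_simps)
      qed
      then show ?thesis by (simp add: dirichlet_def)
    qed
    also have "\<dots> = (\<Sum>(x, y)\<in>arcs. (f x - f y)\<^sup>2) / (b - a)\<^sup>2"
      by (simp add: sum_divide_distrib case_prod_unfold)
    finally show ?thesis using divide_right_mono[OF arcs_le, of "(b - a)\<^sup>2"] by simp
  qed
  ultimately have Ie: "I \<le> e / (b - a)\<^sup>2" by simp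
  have ab: "(b - a)\<^sup>2 > 0" using \<open>a \<noteq> b\<close> by simp
  have "(THE I. \<exists>v. voltage V E A B v \<and> I = current_out E A v) = I"
    unfolding I_def using v current_unique by (intro the_equality) blast+
  then have res: "eff_resistance V E A B = 1 / ereal I" by (simp add: eff_resistance_def)
  show ?thesis
  proof (cases "I = 0")
    case True
    then show ?thesis by (simp add: res divide_ereal_def zero_ereal_def[symmetric])
  next
    case False
    then have "I > 0" using I0 by simp
    have Ie': "I * (b - a)\<^sup>2 \<le> e" using Ie ab by (simp add: pos_le_divide_eq)
    moreover have "0 < I * (b - a)\<^sup>2" using \<open>I > 0\<close> ab by simp
    ultimately have "e > 0" by linarith
    have "(b - a)\<^sup>2 / e \<le> 1 / I"
      using Ie' \<open>I > 0\<close> \<open>e > 0\<close> by (simp add: divide_le_eq le_divide_eq mult.commute)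
    then show ?thesis using \<open>I > 0\<close> by (simp add: res one_ereal_def)
  qed
qed

end

section \<open>The Gray code and powers of two\<close>

lemma sum_powers_of_two_less: "(\<Sum>k<s. 2 ^ k) < (2::nat) ^ s"
  by (induction s) auto

text \<open>
  The bits of \<open>hatpi x\<close> are the parities of the number of nonzero digits from a given index on; so the topmost nonzero
  digit of \<open>x\<close> sits exactly at the leading bit of \<open>hatpi x\<close>.
\<close>

lemma hatpi_less_power_iff:
  assumes x: "x \<in> ends0 m"
  shows "hatpi x < 2 ^ s \<longleftrightarrow> (\<forall>i\<ge>s. x i = 0)"
proof -
  define u where "u = hat (pi01 x)"
  have fin: "finite {i. x i \<noteq> 0}" using x by (simp add: ends0_def)
  have u01: "u k < 2" for k by (simp add: u_def hat_def)
  then have u_le: "u k \<le> 1" for k by (simp add: less_Suc_eq_le[symmetric] numeral_2_eq_2[symmetric])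
  have u0: "u k = 0" if "\<forall>i\<ge>k. x i = 0" for k
  proof -
    have "{i. k \<le> i \<and> pi01 x i \<noteq> 0} = {}" using that by (auto simp: pi01_def)
    then show ?thesis by (simp add: u_def hat_def)
  qed
  have finu: "finite {k. u k \<noteq> 0}"
  proof (rule finite_subset)
    show "{k. u k \<noteq> 0} \<subseteq> (\<Union>i\<in>{i. x i \<noteq> 0}. {..i})" using u0 by fastforce
    show "finite (\<Union>i\<in>{i. x i \<noteq> 0}. {..i})" using fin by blast
  qed
  have val: "hatpi x = (\<Sum>k | u k \<noteq> 0. u k * 2 ^ k)"
    by (simp add: hatpi_def binary_value_def u_def)
  show ?thesis
  proof
    assume *: "\<forall>i\<ge>s. x i = 0"
    have "hatpi x \<le> (\<Sum>k<s. 2 ^ k)"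
      unfolding val
    proof (rule order.trans[OF _ sum_mono2])
      show "(\<Sum>k | u k \<noteq> 0. u k * 2 ^ k) \<le> (\<Sum>k | u k \<noteq> 0. 2 ^ k)"
        using u_le by (intro sum_mono) simp
      show "{k. u k \<noteq> 0} \<subseteq> {..<s}"
      proof
        fix k assume "k \<in> {k. u k \<noteq> 0}"
        then show "k \<in> {..<s}" using u0[of k] * by (cases "s \<le> k") auto
      qed
    qed auto
    then show "hatpi x < 2 ^ s" using sum_powers_of_two_less[of s] by linarith
  next
    assume *: "hatpi x < 2 ^ s"
    show "\<forall>i\<ge>s. x i = 0"
    proof (rule ccontr)
      assume "\<not> ?thesis"
      then obtain i where i: "i \<ge> s" "x i \<noteq> 0" by blast
      define K where "K = Max {i. x i \<noteq> 0}"
      have K: "x K \<noteq> 0" "i \<le> K" using Max_in[OF fin] Max_ge[OF fin] i by (auto simp: K_def)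
      have above: "x j = 0" if "j > K" for j using Max_ge[OF fin, of j] that by (force simp: K_def)
      have "{j. K \<le> j \<and> pi01 x j \<noteq> 0} = {K}" using K above by (force simp: pi01_def le_less)
      then have "u K = 1" using K by (simp add: u_def hat_def pi01_def)
      then have "2 ^ K \<le> hatpi x"
        unfolding val using member_le_sum[of K "{k. u k \<noteq> 0}" "\<lambda>k. u k * 2 ^ k"] finu by simp
      moreover have "(2::nat) ^ s \<le> 2 ^ K" using i K by (intro power_increasing) auto
      ultimately show False using * by linarith
    qed
  qed
qed

section \<open>The resistance coordinate\<close>

locale bounded_digits =
  fixes m :: "nat \<Rightarrow> nat" and M :: nat
  assumes m_ge: "2 \<le> m i" and m_le: "m i \<le> M"
begin

text \<open>
  Give a \<open>0\<close>-\<open>1\<close> pattern of length \<open>n\<close> the weight \<open>1 / \<Prod>(m\<^sub>i - 1)\<close>, the product running over its ones.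
  Expanding the product \<open>\<Prod>(1 + 1 / (m\<^sub>i - 1))\<close> shows that \<open>mass n\<close> is the total weight of all patterns.
\<close>

definition mass :: "nat \<Rightarrow> real" where
  "mass n = (\<Prod>i<n. real (m i) / (real (m i) - 1))"

text \<open>
  The weight of all patterns before that of \<open>x\<close> in Gray code order, plus half the weight of the
  pattern of \<open>x\<close> itself. Counting one's own weight by half makes the recursion exact: the patterns with a
  one in place \<open>n\<close> come after all those with a zero there, in reversed order and with weights divided by
  \<open>m\<^sub>n - 1\<close>.
\<close>

primrec coord :: "nat \<Rightarrow> (nat \<Rightarrow> nat) \<Rightarrow> real" where
  "coord 0 x = 1 / 2"
| "coord (Suc n) x =
    (if x n = 0 then coord n x else mass n + (mass n - coord n x) / (real (m n) - 1))"

lemma M_ge: "2 \<le> M" using m_ge[of 0] m_le[of 0] by linarith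

lemma real_m: "2 \<le> real (m i)" "real (m i) \<le> real M" "1 \<le> real (m i) - 1"
  using m_ge[of i] m_le[of i] by linarith+

lemma mass_0: "mass 0 = 1" by (simp add: mass_def)
lemma mass_Suc: "mass (Suc n) = mass n * (real (m n) / (real (m n) - 1))" by (simp add: mass_def)

lemma mass_pos: "0 < mass n"
proof -
  have "0 < real (m i) / (real (m i) - 1)" for i using real_m[of i] by simp
  then show ?thesis unfolding mass_def by (intro prod_pos) auto
qed

lemma mass_Suc_eq: "mass (Suc n) = mass n + mass n / (real (m n) - 1)"
  using real_m[of n] by (simp add: mass_Suc field_simps)

lemma mass_Suc_le: "mass (Suc n) \<le> 2 * mass n"
proof -
  have "mass n / (real (m n) - 1) \<le> mass n"
    using mass_pos[of n] real_m[of n] mult_left_mono[of 1 "real (m n) - 1" "mass n"]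
    by (simp add: field_simps)
  then show ?thesis by (simp add: mass_Suc_eq)
qed

lemma mass_Suc_ge: "mass n * (1 + 1 / M) \<le> mass (Suc n)"
proof -
  have "mass n / M \<le> mass n / (real (m n) - 1)"
    using mass_pos[of n] real_m[of n] by (intro divide_left_mono) auto
  then show ?thesis by (simp add: mass_Suc_eq algebra_simps)
qed

lemma mass_le_Suc: "mass n \<le> mass (Suc n) * (1 - 1 / M)"
proof -
  have "1 / real M \<le> 1 / real (m n)" using real_m[of n] by (intro divide_left_mono) auto
  moreover have "mass n = mass (Suc n) * (1 - 1 / real (m n))"
    using real_m[of n] by (simp add: mass_Suc field_simps)
  ultimately show ?thesis using mass_pos[of "Suc n"] by simp
qed

lemma mass_mono: "n \<le> k \<Longrightarrow> mass n \<le> mass k"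
proof (rule lift_Suc_mono_le[of mass])
  show "mass n \<le> mass (Suc n)" for n
    using mass_pos[of n] real_m[of n] by (simp add: mass_Suc_eq)
qed

lemma coord_bounds: "0 \<le> coord n x \<and> coord n x \<le> mass n"
proof (induction n)
  case (Suc n)
  have "0 \<le> (mass n - coord n x) / (real (m n) - 1)"
    "(mass n - coord n x) / (real (m n) - 1) \<le> mass n / (real (m n) - 1)"
    using Suc real_m[of n] by (auto intro: divide_right_mono)
  then show ?case using Suc mass_pos[of n] mass_mono[of n "Suc n"] by (auto simp: mass_Suc_eq)
qed (simp add: mass_0)

lemma coord_ge_mass: "x n \<noteq> 0 \<Longrightarrow> mass n \<le> coord (Suc n) x"
  using coord_bounds[of n x] real_m[of n] by simp

lemma coord_cong: "(\<And>i. i < n \<Longrightarrow> (x i = 0) = (y i = 0)) \<Longrightarrow> coord n x = coord n y"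
  by (induction n) auto

lemma coord_update: "n \<le> k \<Longrightarrow> coord n (x(k := c)) = coord n x"
  by (rule coord_cong) auto

lemma coord_stable: "n \<le> k \<Longrightarrow> (\<And>i. n \<le> i \<Longrightarrow> x i = 0) \<Longrightarrow> coord k x = coord n x"
  by (induction k rule: dec_induct) auto

definition box :: "nat \<Rightarrow> (nat \<Rightarrow> nat) set" where
  "box n = {x. (\<forall>i<n. x i < m i) \<and> (\<forall>i\<ge>n. x i = 0)}"

lemma box_0: "box 0 = {\<lambda>_. 0}" by (auto simp: box_def)

lemma box_Suc: "box (Suc n) = (\<lambda>(x, c). x(n := c)) ` (box n \<times> {..<m n})"
proof (intro equalityI subsetI)
  fix y assume y: "y \<in> box (Suc n)"
  then have "y = (\<lambda>(x, c). x(n := c)) (y(n := 0), y n)" "(y(n := 0), y n) \<in> box n \<times> {..<m n}"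
    by (auto simp: box_def Suc_le_eq dest: le_neq_implies_less)
  then show "y \<in> (\<lambda>(x, c). x(n := c)) ` (box n \<times> {..<m n})" by blast
qed (auto simp: box_def less_Suc_eq Suc_le_eq)

lemma inj_on_box_Suc: "inj_on (\<lambda>(x, c). x(n := c)) (box n \<times> {..<m n})"
proof (rule inj_onI, clarify)
  fix x c y c' assume xy: "x \<in> box n" "y \<in> box n" "x(n := c) = y(n := c')"
  have "x i = y i" for i
    using fun_cong[OF xy(3), of i] xy(1,2) by (cases "i = n") (auto simp: box_def)
  then show "x = y \<and> c = c'" using fun_cong[OF xy(3), of n] by auto
qed

lemma finite_box: "finite (box n)"
  by (induction n) (simp_all add: box_0 box_Suc)

lemma sum_box_Suc:
  fixes h :: "(nat \<Rightarrow> nat) \<Rightarrow> real"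
  shows "sum h (box (Suc n)) = (\<Sum>x\<in>box n. h x + (\<Sum>c\<in>{0<..<m n}. h (x(n := c))))"
proof -
  have "sum h (box (Suc n)) = (\<Sum>(x, c)\<in>box n \<times> {..<m n}. h (x(n := c)))"
    unfolding box_Suc by (subst sum.reindex[OF inj_on_box_Suc]) (simp add: case_prod_unfold)
  also have "\<dots> = (\<Sum>x\<in>box n. \<Sum>c<m n. h (x(n := c)))" by (simp add: sum.cartesian_product)
  also have "\<dots> = (\<Sum>x\<in>box n. h x + (\<Sum>c\<in>{0<..<m n}. h (x(n := c))))"
  proof (rule sum.cong[OF refl])
    fix x assume "x \<in> box n"
    then have [simp]: "x(n := 0) = x" by (auto simp: box_def)
    have "{..<m n} = insert 0 {0<..<m n}" using m_ge[of n] by auto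
    then show "(\<Sum>c<m n. h (x(n := c))) = h x + (\<Sum>c\<in>{0<..<m n}. h (x(n := c)))" by simp
  qed
  finally show ?thesis .
qed

definition num_nonzero :: "nat \<Rightarrow> (nat \<Rightarrow> nat) \<Rightarrow> nat" where
  "num_nonzero n x = card {i. i < n \<and> x i \<noteq> 0}"

lemma num_nonzero_0: "num_nonzero 0 x = 0" by (simp add: num_nonzero_def)

lemma num_nonzero_update: "n \<le> k \<Longrightarrow> num_nonzero n (x(k := c)) = num_nonzero n x"
  unfolding num_nonzero_def by (rule arg_cong[where f = card]) auto

lemma num_nonzero_Suc: "num_nonzero (Suc n) x = num_nonzero n x + (if x n = 0 then 0 else 1)"
proof -
  have "{i. i < Suc n \<and> x i \<noteq> 0} = (if x n = 0 then {} else {n}) \<union> {i. i < n \<and> x i \<noteq> 0}"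
    by (auto simp: less_Suc_eq)
  then show ?thesis by (simp add: num_nonzero_def)
qed

text \<open>
  The count is written as a sum of indicators to fit the recursion over boxes. Appending a nonzero
  digit uses up one of the \<open>d\<close> nonzero digits, and there are fewer than \<open>M\<close> choices for it.
\<close>

lemma card_box_num_nonzero_le:
  "(\<Sum>x\<in>box n. if num_nonzero n x \<le> d then 1 else 0) \<le> (1 + real M * n) ^ d"
proof (induction n arbitrary: d)
  case 0
  then show ?case by (simp add: box_0 num_nonzero_0)
next
  case (Suc n)
  let ?N = "\<lambda>d. \<Sum>x\<in>box n. if num_nonzero n x \<le> d then 1 else (0::real)"
  have "(\<Sum>x\<in>box (Suc n). if num_nonzero (Suc n) x \<le> d then 1 else (0::real))
      = (\<Sum>x\<in>box n. (if num_nonzero n x \<le> d then 1 else 0)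
          + (real (m n) - 1) * (if Suc (num_nonzero n x) \<le> d then 1 else 0))"
    unfolding sum_box_Suc using m_ge[of n]
    by (intro sum.cong) (auto simp: num_nonzero_Suc num_nonzero_update box_def of_nat_diff)
  also have "\<dots> = ?N d + (real (m n) - 1) * (\<Sum>x\<in>box n. if Suc (num_nonzero n x) \<le> d then 1 else 0)"
    by (simp add: sum.distrib sum_distrib_left)
  also have "\<dots> \<le> (1 + real M * Suc n) ^ d"
  proof (cases d)
    case 0
    then show ?thesis using Suc[of 0] by simp
  next
    case (Suc d')
    have p: "0 \<le> ?N d'" by (intro sum_nonneg) auto
    have "?N d + (real (m n) - 1) * (\<Sum>x\<in>box n. if Suc (num_nonzero n x) \<le> d then 1 else 0)
        \<le> (1 + real M * n) ^ d + M * (1 + real M * n) ^ d'"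
      using real_m[of n] Suc.IH[of d] Suc.IH[of d'] p
      unfolding Suc Suc_le_mono by (intro add_mono mult_mono) auto
    also have "\<dots> = (1 + real M * Suc n) * (1 + real M * n) ^ d'" by (simp add: Suc algebra_simps)
    also have "\<dots> \<le> (1 + real M * Suc n) * (1 + real M * Suc n) ^ d'"
      by (intro mult_left_mono power_mono) (auto simp: algebra_simps)
    finally show ?thesis by (simp add: Suc)
  qed
  finally show ?case .
qed

text \<open>
  When only \<open>d + 1\<close> digits may be nonzero, the sum is dominated by the ends that have a nonzero digit near
  the top. Those with topmost nonzero digit in place \<open>n\<close> number at most \<open>M (1 + M n)\<^bsup>d\<^esup>\<close> and have coordinate at most
  \<open>mass (n + 1)\<close>, so the geometric growth of \<open>mass\<close> makes the last level comparable to the whole sum.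
  The constant \<open>M\<^sup>2\<close> is the one for which the contraction \<open>1 - 1/M\<close> absorbs the new term.
\<close>

lemma sum_coord_sq_le:
  "(\<Sum>x\<in>box n. if num_nonzero n x \<le> Suc d then (coord n x)\<^sup>2 else 0)
    \<le> real M ^ 2 * (1 + real M * n) ^ d * (mass n)\<^sup>2"
proof (induction n)
  case 0
  have "1 \<le> real M ^ 2" using M_ge by (intro one_le_power) simp
  then show ?case by (simp add: box_0 num_nonzero_0 mass_0 power2_eq_square)
next
  case (Suc n)
  define q where "q = (1 + real M * n) ^ d"
  have q: "0 \<le> q" by (simp add: q_def)
  have "(\<Sum>x\<in>box (Suc n). if num_nonzero (Suc n) x \<le> Suc d then (coord (Suc n) x)\<^sup>2 else 0)
      \<le> (\<Sum>x\<in>box n. (if num_nonzero n x \<le> Suc d then (coord n x)\<^sup>2 else 0)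
          + M * (mass (Suc n))\<^sup>2 * (if num_nonzero n x \<le> d then 1 else 0))"
    unfolding sum_box_Suc
  proof (intro sum_mono add_mono)
    fix x assume x: "x \<in> box n"
    show "(if num_nonzero (Suc n) x \<le> Suc d then (coord (Suc n) x)\<^sup>2 else 0)
        \<le> (if num_nonzero n x \<le> Suc d then (coord n x)\<^sup>2 else 0)"
      using x by (simp add: num_nonzero_Suc box_def)
    have "(\<Sum>c\<in>{0<..<m n}. if num_nonzero (Suc n) (x(n := c)) \<le> Suc d then (coord (Suc n) (x(n := c)))\<^sup>2 else 0)
        \<le> (\<Sum>c\<in>{0<..<m n}. (mass (Suc n))\<^sup>2 * (if num_nonzero n x \<le> d then 1 else 0))"
    proof (intro sum_mono)
      fix c assume c: "c \<in> {0<..<m n}"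
      have "(coord (Suc n) (x(n := c)))\<^sup>2 \<le> (mass (Suc n))\<^sup>2"
        using coord_bounds[of "Suc n" "x(n := c)"] by (intro power_mono) auto
      then show "(if num_nonzero (Suc n) (x(n := c)) \<le> Suc d then (coord (Suc n) (x(n := c)))\<^sup>2 else 0)
          \<le> (mass (Suc n))\<^sup>2 * (if num_nonzero n x \<le> d then 1 else 0)"
        using c unfolding num_nonzero_Suc by (simp add: num_nonzero_update del: coord.simps)
    qed
    also have "\<dots> = real (m n - 1) * ((mass (Suc n))\<^sup>2 * (if num_nonzero n x \<le> d then 1 else 0))"
      by simp
    also have "\<dots> \<le> M * ((mass (Suc n))\<^sup>2 * (if num_nonzero n x \<le> d then 1 else 0))"
      using m_le[of n] by (intro mult_right_mono) auto
    finally show "(\<Sum>c\<in>{0<..<m n}. if num_nonzero (Suc n) (x(n := c)) \<le> Suc d then (coord (Suc n) (x(n := c)))\<^sup>2 else 0)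
        \<le> M * (mass (Suc n))\<^sup>2 * (if num_nonzero n x \<le> d then 1 else 0)"
      by (simp only: mult.assoc)
  qed
  also have "\<dots> = (\<Sum>x\<in>box n. if num_nonzero n x \<le> Suc d then (coord n x)\<^sup>2 else 0)
      + M * (mass (Suc n))\<^sup>2 * (\<Sum>x\<in>box n. if num_nonzero n x \<le> d then 1 else 0)"
    by (simp only: sum.distrib sum_distrib_left)
  also have "\<dots> \<le> real M ^ 2 * q * (mass n)\<^sup>2 + M * (mass (Suc n))\<^sup>2 * q"
    using Suc card_box_num_nonzero_le[of n d] by (intro add_mono mult_left_mono) (auto simp: q_def)
  also have "\<dots> \<le> real M ^ 2 * q * ((mass (Suc n))\<^sup>2 * (1 - 1 / M)) + M * (mass (Suc n))\<^sup>2 * q"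
  proof -
    have "mass n * mass n \<le> (mass (Suc n) * (1 - 1 / M)) * mass (Suc n)"
      using mass_le_Suc[of n] mass_mono[of n "Suc n"] mass_pos[of n] by (intro mult_mono) auto
    then have "(mass n)\<^sup>2 \<le> (mass (Suc n))\<^sup>2 * (1 - 1 / M)" by (simp add: power2_eq_square mult_ac)
    then have "real M ^ 2 * q * (mass n)\<^sup>2 \<le> real M ^ 2 * q * ((mass (Suc n))\<^sup>2 * (1 - 1 / M))"
      using q by (intro mult_left_mono) auto
    then show ?thesis by linarith
  qed
  also have "\<dots> = real M ^ 2 * q * (mass (Suc n))\<^sup>2"
    using M_ge by (simp add: field_simps power2_eq_square)
  also have "\<dots> \<le> real M ^ 2 * (1 + real M * Suc n) ^ d * (mass (Suc n))\<^sup>2"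
    unfolding q_def by (intro mult_right_mono mult_left_mono power_mono) (auto simp: algebra_simps)
  finally show ?case .
qed


section \<open>The energy of the coordinate\<close>

text \<open>
  An edge that changes which digits are nonzero joins an end \<open>y\<close> with \<open>y k \<noteq> 0\<close> to \<open>y(k := 0)\<close>. So it is
  recorded by \<open>k\<close> and \<open>y\<close>; the condition is that for adjacency in degree \<open>d\<close>.
\<close>

definition toggle :: "nat \<Rightarrow> nat \<Rightarrow> (nat \<Rightarrow> nat) \<Rightarrow> bool" where
  "toggle d k y \<longleftrightarrow> y k \<noteq> 0 \<and> (k = 0 \<or> y (k - 1) \<noteq> 0 \<and> num_nonzero (k - 1) y \<le> d)"

definition jump_energy :: "nat \<Rightarrow> nat \<Rightarrow> nat \<Rightarrow> (nat \<Rightarrow> nat) \<Rightarrow> real" where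
  "jump_energy d n k y = (if toggle d k y then (coord n y - coord n (y(k := 0)))\<^sup>2 else 0)"

lemma toggle_update:
  assumes "k < n"
  shows "toggle d k (y(n := c)) = toggle d k y"
proof -
  have "k \<noteq> n" "k - 1 \<noteq> n" "k - 1 \<le> n" using assms by auto
  then show ?thesis by (simp only: toggle_def num_nonzero_update fun_upd_apply if_False)
qed

lemma jump_Suc_zero: "y n = 0 \<Longrightarrow> jump_energy d (Suc n) k y = (if k = n then 0 else jump_energy d n k y)"
  by (auto simp: jump_energy_def toggle_def)

text \<open>
  Reflection beyond a higher nonzero digit reverses the sign and divides the length by \<open>m\<^sub>n - 1\<close>.
\<close>

lemma jump_Suc_nonzero:
  assumes "k < n" "c \<noteq> 0"
  shows "jump_energy d (Suc n) k (y(n := c)) = jump_energy d n k y / (real (m n) - 1)\<^sup>2"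
proof -
  have "y(n := c, k := 0) = y(k := 0, n := c)" using assms by (simp add: fun_upd_twist)
  then have "coord (Suc n) (y(n := c)) - coord (Suc n) (y(n := c, k := 0))
      = - (coord n y - coord n (y(k := 0))) / (real (m n) - 1)"
    using assms by (simp add: coord_update diff_divide_distrib[symmetric])
  then show ?thesis
    using assms by (simp add: jump_energy_def toggle_update power_divide power2_commute)
qed

text \<open>
  Reflection is used twice. Switching on digit \<open>n\<close> reflects the coordinate at \<open>mass n\<close>, which moves it by at most twice
  its distance from \<open>mass n\<close>. Since digit \<open>n - 1\<close> is nonzero, that distance is the coordinate
  of the first \<open>n - 1\<close> digits divided by \<open>m\<^bsub>n-1\<^esub> - 1\<close>, and at most \<open>d + 1\<close> of these digits are nonzero.
\<close>

lemma sum_new_jump_le: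
  "(\<Sum>y\<in>box n. \<Sum>c\<in>{0<..<m n}. jump_energy (Suc d) (Suc n) n (y(n := c)))
    \<le> 4 * real M ^ 3 * (1 + real M * n) ^ d * (mass n)\<^sup>2"
proof -
  let ?Q = "\<lambda>n. \<Sum>x\<in>box n. if num_nonzero n x \<le> Suc d then (coord n x)\<^sup>2 else 0"
  define ok where "ok y \<longleftrightarrow> n = 0 \<or> y (n - 1) \<noteq> 0 \<and> num_nonzero (n - 1) y \<le> Suc d" for y
  have old_le: "(\<Sum>y\<in>box n. if ok y then (mass n - coord n y)\<^sup>2 else 0) \<le> ?Q (n - 1)"
  proof (cases n)
    case 0
    then show ?thesis by (simp add: box_0 ok_def num_nonzero_0 mass_0)
  next
    case (Suc l)
    have "(\<Sum>y\<in>box (Suc l). if ok y then (mass n - coord n y)\<^sup>2 else 0)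
        \<le> (\<Sum>x\<in>box l. 0 + (if num_nonzero l x \<le> Suc d then (coord l x)\<^sup>2 else 0))"
      unfolding sum_box_Suc
    proof (intro sum_mono add_mono)
      fix x assume x: "x \<in> box l"
      show "(if ok x then (mass n - coord n x)\<^sup>2 else 0) \<le> 0"
        using x by (simp add: ok_def Suc box_def)
      have "(if ok (x(l := c)) then (mass n - coord n (x(l := c)))\<^sup>2 else 0)
          = (if num_nonzero l x \<le> Suc d then (coord l x)\<^sup>2 else 0) / (real (m l) - 1)\<^sup>2"
        if "c \<in> {0<..<m l}" for c
      proof -
        have "mass n - coord n (x(l := c)) = coord l x / (real (m l) - 1)"
          using that by (simp add: Suc coord_update mass_Suc_eq diff_divide_distrib)
        then show ?thesis using that by (simp add: ok_def Suc num_nonzero_update power_divide)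
      qed
      then have "(\<Sum>c\<in>{0<..<m l}. if ok (x(l := c)) then (mass n - coord n (x(l := c)))\<^sup>2 else 0)
          = real (card {0<..<m l}) * ((if num_nonzero l x \<le> Suc d then (coord l x)\<^sup>2 else 0) / (real (m l) - 1)\<^sup>2)"
        by simp
      also have "\<dots> = (if num_nonzero l x \<le> Suc d then (coord l x)\<^sup>2 else 0) / (real (m l) - 1)"
        using real_m[of l] m_ge[of l] by (simp add: of_nat_diff power2_eq_square)
      also have "\<dots> \<le> (if num_nonzero l x \<le> Suc d then (coord l x)\<^sup>2 else 0) / 1"
        using real_m[of l] by (intro divide_left_mono) auto
      finally show "(\<Sum>c\<in>{0<..<m l}. if ok (x(l := c)) then (mass n - coord n (x(l := c)))\<^sup>2 else 0)
          \<le> (if num_nonzero l x \<le> Suc d then (coord l x)\<^sup>2 else 0)" by simp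
    qed
    then show ?thesis unfolding Suc diff_Suc_1 add_0 .
  qed
  have Q_le: "?Q (n - 1) \<le> real M ^ 2 * (1 + real M * n) ^ d * (mass n)\<^sup>2"
  proof (rule order.trans[OF sum_coord_sq_le])
    show "real M ^ 2 * (1 + real M * real (n - 1)) ^ d * (mass (n - 1))\<^sup>2
        \<le> real M ^ 2 * (1 + real M * n) ^ d * (mass n)\<^sup>2"
      using mass_mono[of "n - 1" n] mass_pos[of "n - 1"]
      by (intro mult_mono power_mono add_left_mono mult_left_mono) auto
  qed
  have "(\<Sum>y\<in>box n. \<Sum>c\<in>{0<..<m n}. jump_energy (Suc d) (Suc n) n (y(n := c)))
      \<le> (\<Sum>y\<in>box n. 4 * M * (if ok y then (mass n - coord n y)\<^sup>2 else 0))"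
  proof (intro sum_mono)
    fix y assume y: "y \<in> box n"
    have "y(n := 0) = y" using y by (auto simp: box_def)
    then have diff: "coord (Suc n) (y(n := c)) - coord (Suc n) (y(n := 0))
        = (mass n - coord n y) * (1 + 1 / (real (m n) - 1))" if "c \<noteq> 0" for c
      using that y by (simp add: coord_update box_def diff_divide_distrib algebra_simps)
    have one: "1 / (real (m n) - 1) \<le> 1" using real_m[of n] by simp
    have "jump_energy (Suc d) (Suc n) n (y(n := c)) \<le> 4 * (if ok y then (mass n - coord n y)\<^sup>2 else 0)"
      if "c \<in> {0<..<m n}" for c
    proof -
      have tg: "toggle (Suc d) n (y(n := c)) = ok y"
        using that by (auto simp: toggle_def ok_def num_nonzero_update)
      have "(1 + 1 / (real (m n) - 1))\<^sup>2 \<le> 2\<^sup>2"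
        using one real_m[of n] by (intro power_mono) auto
      then have "(mass n - coord n y)\<^sup>2 * (1 + 1 / (real (m n) - 1))\<^sup>2 \<le> (mass n - coord n y)\<^sup>2 * 4"
        by (intro mult_left_mono) auto
      then show ?thesis
        using diff[of c] that by (simp add: jump_energy_def tg power_mult_distrib del: coord.simps)
    qed
    then have "(\<Sum>c\<in>{0<..<m n}. jump_energy (Suc d) (Suc n) n (y(n := c)))
        \<le> real (card {0<..<m n}) * (4 * (if ok y then (mass n - coord n y)\<^sup>2 else 0))"
      by (rule sum_bounded_above)
    also have "\<dots> \<le> M * (4 * (if ok y then (mass n - coord n y)\<^sup>2 else 0))"
      using m_le[of n] by (intro mult_right_mono) auto
    finally show "(\<Sum>c\<in>{0<..<m n}. jump_energy (Suc d) (Suc n) n (y(n := c)))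
        \<le> 4 * M * (if ok y then (mass n - coord n y)\<^sup>2 else 0)"
      by (simp only: mult_ac)
  qed
  also have "\<dots> = 4 * M * (\<Sum>y\<in>box n. if ok y then (mass n - coord n y)\<^sup>2 else 0)"
    by (simp only: sum_distrib_left)
  also have "\<dots> \<le> 4 * M * (real M ^ 2 * (1 + real M * n) ^ d * (mass n)\<^sup>2)"
    by (intro mult_left_mono order.trans[OF old_le Q_le]) simp
  finally show ?thesis by (simp add: power3_eq_cube power2_eq_square mult_ac)
qed

text \<open>
  Passing from \<open>n\<close> to \<open>n + 1\<close> digits copies each old edge once with its length and \<open>m\<^sub>n - 1\<close> times with its
  length divided by \<open>m\<^sub>n - 1\<close>, so the old energy is multiplied by \<open>m\<^sub>n / (m\<^sub>n - 1)\<close>, just as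
  \<open>mass n\<close> is. The bound grows by the square of that factor, which leaves room for the edges that switch digit \<open>n\<close>.
\<close>

theorem sum_jumps_le:
  "(\<Sum>y\<in>box n. \<Sum>k<n. jump_energy (Suc d) n k y)
    \<le> 4 * real M ^ 4 * (1 + real M * n) ^ d * (mass n)\<^sup>2"
proof (induction n)
  case (Suc n)
  define q where "q = (1 + real M * n) ^ d"
  have q: "0 \<le> q" by (simp add: q_def)
  let ?R = "\<lambda>y. \<Sum>k<n. jump_energy (Suc d) n k y"
  have r: "real (m n - Suc 0) = real (m n) - 1" using m_ge[of n] by (simp add: of_nat_diff)
  have "(\<Sum>y\<in>box (Suc n). \<Sum>k<Suc n. jump_energy (Suc d) (Suc n) k y)
      = (\<Sum>y\<in>box n. ?R y + ((real (m n) - 1) * (?R y / (real (m n) - 1)\<^sup>2)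
          + (\<Sum>c\<in>{0<..<m n}. jump_energy (Suc d) (Suc n) n (y(n := c)))))"
    unfolding sum_box_Suc
  proof (rule sum.cong[OF refl])
    fix y assume y: "y \<in> box n"
    then have old: "(\<Sum>k<Suc n. jump_energy (Suc d) (Suc n) k y) = ?R y"
      by (simp add: jump_Suc_zero box_def)
    have "(\<Sum>c\<in>{0<..<m n}. \<Sum>k<Suc n. jump_energy (Suc d) (Suc n) k (y(n := c)))
        = (\<Sum>c\<in>{0<..<m n}. ?R y / (real (m n) - 1)\<^sup>2 + jump_energy (Suc d) (Suc n) n (y(n := c)))"
      by (intro sum.cong) (simp_all add: jump_Suc_nonzero sum_divide_distrib)
    then have new: "(\<Sum>c\<in>{0<..<m n}. \<Sum>k<Suc n. jump_energy (Suc d) (Suc n) k (y(n := c)))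
        = (real (m n) - 1) * (?R y / (real (m n) - 1)\<^sup>2)
          + (\<Sum>c\<in>{0<..<m n}. jump_energy (Suc d) (Suc n) n (y(n := c)))"
      by (simp add: sum.distrib r)
    show "(\<Sum>k<Suc n. jump_energy (Suc d) (Suc n) k y)
          + (\<Sum>c\<in>{0<..<m n}. \<Sum>k<Suc n. jump_energy (Suc d) (Suc n) k (y(n := c)))
        = ?R y + ((real (m n) - 1) * (?R y / (real (m n) - 1)\<^sup>2)
          + (\<Sum>c\<in>{0<..<m n}. jump_energy (Suc d) (Suc n) n (y(n := c))))"
      by (simp only: old new)
  qed
  also have "\<dots> = sum ?R (box n) + (real (m n) - 1) * (sum ?R (box n) / (real (m n) - 1)\<^sup>2)
      + (\<Sum>y\<in>box n. \<Sum>c\<in>{0<..<m n}. jump_energy (Suc d) (Suc n) n (y(n := c)))"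
    by (simp add: sum.distrib sum_distrib_left sum_divide_distrib)
  also have "sum ?R (box n) + (real (m n) - 1) * (sum ?R (box n) / (real (m n) - 1)\<^sup>2)
      = sum ?R (box n) * (real (m n) / (real (m n) - 1))"
  proof -
    have "S + a * (S / a\<^sup>2) = S * ((a + 1) / a)" if "a > 0" for S a :: real
      using that by (simp add: power2_eq_square field_simps)
    from this[of "real (m n) - 1"] show ?thesis using real_m(3)[of n] by simp
  qed
  also have "\<dots> \<le> (4 * real M ^ 4 * q * (mass n)\<^sup>2) * (real (m n) / (real (m n) - 1))"
    using Suc real_m[of n] by (intro mult_right_mono) (auto simp: q_def)
  also have "\<dots> = 4 * real M ^ 4 * q * (mass n * mass (Suc n))"
    by (simp add: mass_Suc power2_eq_square)
  finally have "(\<Sum>y\<in>box (Suc n). \<Sum>k<Suc n. jump_energy (Suc d) (Suc n) k y)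
      \<le> 4 * real M ^ 4 * q * (mass n * mass (Suc n)) + 4 * real M ^ 3 * q * (mass n)\<^sup>2"
    using sum_new_jump_le[where n = n and d = d, folded q_def] by linarith
  \<comment> \<open>the room left is one factor \<open>mass (Suc n) / mass n\<close>, which is at least \<open>1 + 1 / M\<close>\<close>
  also have "\<dots> = 4 * real M ^ 4 * q * (mass n * (mass (Suc n) + mass n / M))"
    using M_ge by (simp add: field_simps power2_eq_square eval_nat_numeral)
  also have "\<dots> \<le> 4 * real M ^ 4 * q * (mass (Suc n))\<^sup>2"
  proof (intro mult_left_mono)
    have "mass n * (1 / M) \<le> mass (Suc n) * (1 / M)"
      using mass_mono[of n "Suc n"] by (intro mult_right_mono) auto
    then have "mass n * (mass (Suc n) + mass n / M) \<le> mass n * (mass (Suc n) * (1 + 1 / M))"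
      using mass_pos[of n] by (intro mult_left_mono) (auto simp: algebra_simps)
    also have "\<dots> = (mass n * (1 + 1 / M)) * mass (Suc n)" by simp
    also have "\<dots> \<le> mass (Suc n) * mass (Suc n)"
      using mass_Suc_ge[of n] mass_pos[of "Suc n"] by (intro mult_right_mono) auto
    finally show "mass n * (mass (Suc n) + mass n / M) \<le> (mass (Suc n))\<^sup>2"
      by (simp add: power2_eq_square)
  qed (use q in simp)
  also have "\<dots> \<le> 4 * real M ^ 4 * (1 + real M * Suc n) ^ d * (mass (Suc n))\<^sup>2"
    unfolding q_def by (intro mult_right_mono mult_left_mono power_mono) (auto simp: algebra_simps)
  finally show ?case .
qed (simp add: mass_0)

section \<open>Potentials on the Schreier graph\<close>

definition height :: "(nat \<Rightarrow> nat) \<Rightarrow> nat" where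
  "height x = (LEAST n. \<forall>i\<ge>n. x i = 0)"

definition position :: "(nat \<Rightarrow> nat) \<Rightarrow> real" where
  "position x = coord (height x) x"

lemma box_eq: "box n = {x \<in> ends0 m. \<forall>i\<ge>n. x i = 0}"
proof -
  have "finite {i. x i \<noteq> 0}" if "\<forall>i\<ge>n. x i = 0" for x :: "nat \<Rightarrow> nat"
    by (rule finite_subset[of _ "{..<n}"]) (use that in \<open>force simp: not_less[symmetric]\<close>)+
  moreover have "x i < m i" if "x \<in> box n" for x i
    using that m_ge[of i] by (cases "i < n") (auto simp: box_def)
  ultimately show ?thesis by (auto simp: box_def ends0_def)
qed

lemma height_le_iff:
  assumes "x \<in> ends0 m"
  shows "height x \<le> n \<longleftrightarrow> (\<forall>i\<ge>n. x i = 0)"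
proof -
  have "finite {i. x i \<noteq> 0}" using assms by (simp add: ends0_def)
  then obtain b where "\<forall>i\<in>{i. x i \<noteq> 0}. i < b" using finite_nat_set_iff_bounded by blast
  then have "\<forall>i\<ge>b. x i = 0" by (force simp: not_less[symmetric])
  then have above: "\<forall>i\<ge>height x. x i = 0" unfolding height_def by (rule LeastI)
  show ?thesis
  proof
    assume "height x \<le> n"
    then show "\<forall>i\<ge>n. x i = 0" using above order.trans by blast
  next
    assume "\<forall>i\<ge>n. x i = 0"
    then show "height x \<le> n" unfolding height_def by (rule Least_le)
  qed
qed

lemma height_Suc:
  assumes x: "x \<in> ends0 m" and k: "x k \<noteq> 0"
  obtains K where "height x = Suc K" "k \<le> K" "x K \<noteq> 0" "x \<in> box (Suc K)"
proof -
  have "k < height x" using height_le_iff[OF x, of k] k by auto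
  then obtain K where K: "height x = Suc K" "k \<le> K" by (cases "height x") auto
  then have above: "\<forall>i\<ge>Suc K. x i = 0" using height_le_iff[OF x, of "Suc K"] by simp
  have "\<exists>i\<ge>K. x i \<noteq> 0" using height_le_iff[OF x, of K] K by simp
  then obtain i where "i \<ge> K" "x i \<noteq> 0" by blast
  with above have "x K \<noteq> 0" using not_less_eq_eq[of i K] by (cases "i = K") auto
  with K above x show thesis by (intro that[of K]) (auto simp: box_eq)
qed

lemma position_eq: "x \<in> box n \<Longrightarrow> position x = coord n x"
proof -
  assume "x \<in> box n"
  then have x: "x \<in> ends0 m" "height x \<le> n" using height_le_iff[of x n] by (auto simp: box_eq)
  have "x i = 0" if "height x \<le> i" for i using height_le_iff[OF x(1), of "height x"] that by simp
  then show ?thesis unfolding position_def using coord_stable[of "height x" n x] x(2) by simp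
qed

lemma position_le: "x \<in> box n \<Longrightarrow> position x \<le> mass n"
  using coord_bounds[of n x] by (simp add: position_eq)

lemma position_ge:
  assumes "x \<in> ends0 m" "x n \<noteq> 0"
  shows "mass n \<le> position x"
proof -
  obtain K where K: "n \<le> K" "x K \<noteq> 0" "x \<in> box (Suc K)" using height_Suc[OF assms] by blast
  have "mass K \<le> position x"
    unfolding position_eq[OF K(3)] by (rule coord_ge_mass[of x K, OF K(2)])
  then show ?thesis using mass_mono[OF K(1)] by linarith
qed

lemma position_cong:
  assumes "x \<in> ends0 m" "\<And>i. (x i = 0) = (y i = 0)"
  shows "position x = position y"
proof -
  have "height x = height y" using assms by (simp add: height_def)
  then show ?thesis using assms by (simp add: position_def coord_cong[of _ x y])
qed

lemma update_zero_in_ends0: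
  assumes "y \<in> ends0 m"
  shows "y(k := 0) \<in> ends0 m"
proof -
  have "{i. (y(k := 0)) i \<noteq> 0} \<subseteq> {i. y i \<noteq> 0}" by auto
  moreover have "0 < m k" using m_ge[of k] by linarith
  ultimately show ?thesis using assms by (auto simp: ends0_def intro: finite_subset)
qed

text \<open>
  Even if digit \<open>K\<close> itself is switched off, digit \<open>K - 1\<close> is nonzero by the adjacency condition; so at most
  one scale is lost.
\<close>

lemma position_lower_end_ge:
  assumes y: "y \<in> ends0 m" and tg: "toggle d k y" and K: "y K \<noteq> 0" "0 < K" "k \<le> K"
  shows "mass (K - 1) \<le> position (y(k := 0))"
proof (cases "k = K")
  case True
  then show ?thesis
    using tg K by (intro position_ge update_zero_in_ends0 y) (auto simp: toggle_def)
next
  case False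
  then have "mass K \<le> position (y(k := 0))"
    using K by (intro position_ge update_zero_in_ends0 y) auto
  then show ?thesis using mass_mono[of "K - 1" K] by simp
qed

text \<open>
  Exchanging one nonzero digit for another does not move the coordinate, so only edges that switch a digit on or off matter.
\<close>

lemma edge_is_toggle:
  assumes e: "(x, y) \<in> mother_edges d m" and neq: "position x \<noteq> position y"
  shows "(\<exists>k. toggle d k y \<and> x = y(k := 0)) \<or> (\<exists>k. toggle d k x \<and> y = x(k := 0))"
proof -
  have xy: "x \<in> ends0 m" "y \<in> ends0 m" "x \<noteq> y"
    using e by (auto simp: mother_edges_def schreier_edges_def)
  obtain k where k: "x k \<noteq> y k" "\<forall>i. i \<noteq> k \<longrightarrow> x i = y i"
    and c: "k = 0 \<or> x (k - 1) = y (k - 1) \<and> x (k - 1) \<noteq> 0 \<and> card {i. i < k - 1 \<and> x i \<noteq> 0} \<le> d"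
    using mother_edges_iff[OF xy] e by blast
  have "x k = 0 \<or> y k = 0"
  proof (rule ccontr)
    assume "\<not> ?thesis"
    then have "position x = position y" using k by (intro position_cong xy) metis
    with neq show False ..
  qed
  then show ?thesis
  proof
    assume "x k = 0"
    then have x: "x = y(k := 0)" using k(2) by auto
    have "toggle d k y"
    proof (cases "k = 0")
      case False
      then have "num_nonzero (k - 1) x = num_nonzero (k - 1) y" unfolding x by (intro num_nonzero_update) simp
      then show ?thesis using False c k \<open>x k = 0\<close> by (auto simp: toggle_def num_nonzero_def)
    qed (use k \<open>x k = 0\<close> in \<open>auto simp: toggle_def\<close>)
    with x show ?thesis by blast
  next
    assume "y k = 0"
    then have "y = x(k := 0)" using k(2) by auto
    moreover have "toggle d k x" using c k \<open>y k = 0\<close> by (auto simp: toggle_def num_nonzero_def)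
    ultimately show ?thesis by blast
  qed
qed

lemma finite_mother_nbrs: "finite {y. (x, y) \<in> mother_edges d m}"
proof (cases "x \<in> ends0 m")
  case True
  have "{y. (x, y) \<in> mother_edges d m} \<subseteq> (\<Union>k\<le>height x. (\<lambda>c. x(k := c)) ` {..<m k})"
  proof
    fix y assume "y \<in> {y. (x, y) \<in> mother_edges d m}"
    then have e: "(x, y) \<in> mother_edges d m" by simp
    then have y: "y \<in> ends0 m" "x \<noteq> y" by (auto simp: mother_edges_def schreier_edges_def)
    obtain k where k: "\<forall>i. i \<noteq> k \<longrightarrow> x i = y i" "k = 0 \<or> x (k - 1) \<noteq> 0"
      using mother_edges_iff[OF True y] e by blast
    have "k \<le> height x"
      using k(2) height_le_iff[OF True, of "k - 1"] by (cases "k = 0") auto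
    moreover have "y = x(k := y k)" using k(1) by auto
    moreover have "y k < m k" using y by (simp add: ends0_def)
    ultimately show "y \<in> (\<Union>k\<le>height x. (\<lambda>c. x(k := c)) ` {..<m k})" by blast
  qed
  then show ?thesis by (rule finite_subset) auto
next
  case False
  then show ?thesis by (simp add: mother_edges_def schreier_edges_def)
qed

text \<open>
  The test function is \<open>g\<close> of the coordinate, truncated to the segment from \<open>mass s\<close> to \<open>mass t\<close>. An edge whose upper
  end has its topmost nonzero digit in place \<open>K\<close> has both coordinates at least \<open>mass (K - 1)\<close>, so
  after truncation it lies where \<open>L K\<close> is a Lipschitz constant of \<open>g\<close>; and truncation makes the
  test function constant along it unless \<open>s \<le> K \<le> t\<close>.
\<close>

theorem mother_Res_ge_of_potential:
  assumes st: "0 < s" "s < t"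
    and lip: "\<And>K a b. s \<le> K \<Longrightarrow> K \<le> t \<Longrightarrow> mass (max s (K - 1)) \<le> a \<Longrightarrow> mass (max s (K - 1)) \<le> b
      \<Longrightarrow> \<bar>g a - g b\<bar> \<le> L K * \<bar>a - b\<bar>"
    and neq: "g (mass s) \<noteq> g (mass t)"
    and bound: "(\<Sum>K=s..t. (L K)\<^sup>2 * (4 * real M ^ 4 * (1 + real M * Suc K) ^ d * (mass (Suc K))\<^sup>2)) \<le> e"
  shows "ereal ((g (mass t) - g (mass s))\<^sup>2 / e)
    \<le> mother_Res (Suc d) m (ends0 m \<inter> hatpi -` {0..<2 ^ s}) (ends0 m \<inter> hatpi -` {2 ^ t..})"
proof -
  define A B where "A = ends0 m \<inter> hatpi -` {0..<2 ^ s}" and "B = ends0 m \<inter> hatpi -` {2 ^ t..}"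
  have A: "A = box s" by (auto simp: A_def box_eq hatpi_less_power_iff)
  have B: "B = ends0 m - box t" by (auto simp: B_def box_eq not_less[symmetric] hatpi_less_power_iff)
  interpret finite_network "ends0 m" "mother_edges (Suc d) m" A B
  proof
    show "(y, x) \<in> mother_edges (Suc d) m" if "(x, y) \<in> mother_edges (Suc d) m" for x y
      using that by (auto simp: mother_edges_def schreier_edges_def)
    show "mother_edges (Suc d) m \<subseteq> ends0 m \<times> ends0 m"
      by (auto simp: mother_edges_def schreier_edges_def)
    show "finite {y. (x, y) \<in> mother_edges (Suc d) m}" for x by (rule finite_mother_nbrs)
    show "finite (ends0 m - B)" using finite_box[of t] by (rule rev_finite_subset) (auto simp: B)
    show "A \<subseteq> ends0 m - B" using st by (auto simp: A B box_eq)
    show "B \<subseteq> ends0 m" by (auto simp: B)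
  qed
  define clamp where "clamp a = max (mass s) (min (mass t) a)" for a
  define f where "f x = g (clamp (position x))" for x
  have st': "mass s \<le> mass t" using st by (intro mass_mono) simp
  \<comment> \<open>\<open>K\<close> is the place of the topmost nonzero digit of \<open>y\<close>, and \<open>k\<close> the place of the digit switched off\<close>
  define T where "T = (SIGMA K:{s..t}. box (Suc K) \<times> {..<Suc K})"
  define J where "J = {(K, y, k) \<in> T. y K \<noteq> 0 \<and> toggle (Suc d) k y}"
  define arc where "arc = (\<lambda>(K::nat, y::nat \<Rightarrow> nat, k::nat). (y(k := 0), y))"
  have finT: "finite T" unfolding T_def by (intro finite_SigmaI finite_cartesian_product finite_box) auto
  have finJ: "finite J" by (rule finite_subset[OF _ finT]) (auto simp: J_def)
  have covered: "(y(k := 0), y) \<in> arc ` J"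
    if y: "y \<in> ends0 m" and tg: "toggle (Suc d) k y" and ne: "f (y(k := 0)) \<noteq> f y" for y k
  proof -
    have "y k \<noteq> 0" using tg by (simp add: toggle_def)
    then obtain K where K: "k \<le> K" "y K \<noteq> 0" "y \<in> box (Suc K)" using height_Suc[OF y] by blast
    have x: "y(k := 0) \<in> box (Suc K)" using K y by (auto simp: box_eq update_zero_in_ends0)
    have "s \<le> K"
    proof (rule ccontr)
      assume "\<not> s \<le> K"
      then have "mass (Suc K) \<le> mass s" by (intro mass_mono) simp
      then have "position y \<le> mass s" "position (y(k := 0)) \<le> mass s"
        using position_le[OF K(3)] position_le[OF x] by linarith+
      with ne show False by (simp add: f_def clamp_def max_absorb1)
    qed
    moreover have "K \<le> t"
    proof (rule ccontr)
      assume "\<not> K \<le> t"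
      then have "mass t \<le> mass (K - 1)" "mass t \<le> mass K" "0 < K" by (auto intro!: mass_mono)
      then have "mass t \<le> position y" "mass t \<le> position (y(k := 0))"
        using position_ge[OF y K(2)] position_lower_end_ge[OF y tg K(2) _ K(1)] by linarith+
      with ne show False by (simp add: f_def clamp_def min_absorb1)
    qed
    ultimately have "(K, y, k) \<in> J" using K tg by (simp add: J_def T_def)
    then show ?thesis by (force simp: arc_def)
  qed
  have step: "(f (y(k := 0)) - f y)\<^sup>2 \<le> (L K)\<^sup>2 * jump_energy (Suc d) (Suc K) k y" if "(K, y, k) \<in> J" for K y k
  proof -
    have K: "s \<le> K" "K \<le> t" "y \<in> box (Suc K)" "k \<le> K" "y K \<noteq> 0" and tg: "toggle (Suc d) k y"
      using that by (auto simp: J_def T_def)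
    have y: "y \<in> ends0 m" using K by (simp add: box_eq)
    have x: "y(k := 0) \<in> box (Suc K)" using K y by (auto simp: box_eq update_zero_in_ends0)
    have "mass (K - 1) \<le> position (y(k := 0))"
      using position_lower_end_ge[OF y tg K(5) _ K(4)] K(1) st by simp
    moreover have "mass (K - 1) \<le> position y"
      using position_ge[OF y K(5)] mass_mono[of "K - 1" K] by simp
    moreover have "mass (K - 1) \<le> mass t" using K by (intro mass_mono) simp
    moreover have "mass (max s (K - 1)) = max (mass s) (mass (K - 1))"
      using mass_mono[of s "K - 1"] mass_mono[of "K - 1" s] by (cases "s \<le> K - 1") (auto simp: max_def)
    ultimately have "mass (max s (K - 1)) \<le> clamp (position (y(k := 0)))"
      "mass (max s (K - 1)) \<le> clamp (position y)" by (auto simp: clamp_def le_max_iff_disj)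
    from lip[OF K(1,2) this]
    have "\<bar>f (y(k := 0)) - f y\<bar> \<le> L K * \<bar>clamp (position (y(k := 0))) - clamp (position y)\<bar>"
      by (simp add: f_def)
    then have "(f (y(k := 0)) - f y)\<^sup>2 \<le> (L K * \<bar>clamp (position (y(k := 0))) - clamp (position y)\<bar>)\<^sup>2"
      by (metis abs_ge_zero power2_abs power_mono)
    also have "\<dots> = (L K)\<^sup>2 * \<bar>clamp (position (y(k := 0))) - clamp (position y)\<bar>\<^sup>2"
      by (simp add: power_mult_distrib)
    also have "\<dots> \<le> (L K)\<^sup>2 * \<bar>position (y(k := 0)) - position y\<bar>\<^sup>2"
      by (intro mult_left_mono power_mono) (auto simp: clamp_def)
    also have "\<dots> = (L K)\<^sup>2 * jump_energy (Suc d) (Suc K) k y"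
      using tg by (simp add: jump_energy_def position_eq[OF x] position_eq[OF K(3)] power2_commute del: coord.simps)
    finally show ?thesis .
  qed
  have "(\<Sum>(x, y)\<in>arc ` J. (f x - f y)\<^sup>2) \<le> (\<Sum>j\<in>J. (\<lambda>(x, y). (f x - f y)\<^sup>2) (arc j))"
    using sum_image_le[OF finJ, of "\<lambda>(x, y). (f x - f y)\<^sup>2" arc] by (simp add: split_beta o_def)
  also have "\<dots> \<le> (\<Sum>(K, y, k)\<in>J. (L K)\<^sup>2 * jump_energy (Suc d) (Suc K) k y)"
    by (intro sum_mono) (auto simp: arc_def step)
  also have "\<dots> \<le> (\<Sum>(K, y, k)\<in>T. (L K)\<^sup>2 * jump_energy (Suc d) (Suc K) k y)"
    using finT by (intro sum_mono2) (auto simp: J_def jump_energy_def)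
  also have "\<dots> = (\<Sum>K=s..t. \<Sum>(y, k)\<in>box (Suc K) \<times> {..<Suc K}. (L K)\<^sup>2 * jump_energy (Suc d) (Suc K) k y)"
    unfolding T_def by (subst sum.Sigma[symmetric]) (auto intro!: finite_cartesian_product finite_box)
  also have "\<dots> = (\<Sum>K=s..t. (L K)\<^sup>2 * (\<Sum>y\<in>box (Suc K). \<Sum>k<Suc K. jump_energy (Suc d) (Suc K) k y))"
    by (simp only: sum.cartesian_product[symmetric] sum_distrib_left)
  also have "\<dots> \<le> (\<Sum>K=s..t. (L K)\<^sup>2 * (4 * real M ^ 4 * (1 + real M * Suc K) ^ d * (mass (Suc K))\<^sup>2))"
    by (intro sum_mono mult_left_mono sum_jumps_le) auto
  also note bound
  finally have energy: "(\<Sum>(x, y)\<in>arc ` J. (f x - f y)\<^sup>2) \<le> e" .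
  show ?thesis
    unfolding mother_Res_def A_def[symmetric] B_def[symmetric]
  proof (rule dirichlet_lower_bound[where f = f and P = "arc ` J"])
    show "f x = g (mass s)" if "x \<in> A" for x
      using that position_le[of x s] by (simp add: A f_def clamp_def max_absorb1)
    show "f x = g (mass t)" if x: "x \<in> B" for x
    proof -
      obtain i where i: "x \<in> ends0 m" "t \<le> i" "x i \<noteq> 0" using x unfolding B box_eq by blast
      then have "mass t \<le> position x" using position_ge[of x i] mass_mono[of t i] by linarith
      then show ?thesis using st' by (simp add: f_def clamp_def min_absorb1 max_absorb2)
    qed
    show "finite (arc ` J)" using finJ by simp
    show "(x, y) \<in> arc ` J \<or> (y, x) \<in> arc ` J" if e: "(x, y) \<in> mother_edges (Suc d) m" and ne: "f x \<noteq> f y" for x y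
    proof -
      have "position x \<noteq> position y" using ne by (auto simp: f_def)
      from edge_is_toggle[OF e this] show ?thesis
        using covered[of y] covered[of x] e edges_in ne by auto
    qed
  qed (use neq energy in auto)
qed

section \<open>Logarithmic and doubly logarithmic potentials\<close>

lemma ln_lipschitz_above:
  fixes a b c :: real
  assumes "0 < c" "c \<le> a" "c \<le> b"
  shows "\<bar>ln a - ln b\<bar> \<le> \<bar>a - b\<bar> / c"
proof -
  have *: "ln a - ln b \<le> (a - b) / c" if "b \<le> a" "c \<le> b" for a b
  proof -
    have "ln a - ln b = ln (a / b)" using that \<open>0 < c\<close> by (simp add: ln_div)
    also have "\<dots> \<le> a / b - 1" using that \<open>0 < c\<close> by (intro ln_le_minus_one) simp
    also have "\<dots> = (a - b) / b" using that \<open>0 < c\<close> by (simp add: field_simps)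
    also have "\<dots> \<le> (a - b) / c" using that \<open>0 < c\<close> by (intro divide_left_mono) auto
    finally show ?thesis .
  qed
  have "ln b \<le> ln a \<longleftrightarrow> b \<le> a" using assms by simp
  then show ?thesis using *[of b a] *[of a b] assms by (cases "b \<le> a") (auto simp: abs_if)
qed

text \<open>
  The sum has \<open>t - s + 1\<close> terms, one more than the logarithm accounts for; the first term is at most twice the
  second one, whence the factor \<open>3\<close>.
\<close>

lemma sum_inverse_le_ln:
  assumes "0 < s" "s < t"
  shows "(\<Sum>K=s..t. 1 / real K) \<le> 3 * (ln (real t) - ln (real s))"
proof -
  have increment: "1 / real (Suc n) \<le> ln (real (Suc n)) - ln (real n)" if "0 < n" for n
  proof -
    have "ln (real n / real (Suc n)) \<le> real n / real (Suc n) - 1"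
      using that by (intro ln_le_minus_one) simp
    then show ?thesis using that by (simp add: ln_div field_simps)
  qed
  have tail: "(\<Sum>K=Suc s..t. 1 / real K) \<le> ln (real t) - ln (real s)" if "s \<le> t" for t
    using that
  proof (induction t rule: dec_induct)
    case (step n)
    then show ?case using \<open>0 < s\<close> increment[of n] by simp
  qed simp
  have "1 / real s \<le> 2 * (1 / real (Suc s))" using assms by (simp add: field_simps)
  also have "\<dots> \<le> 2 * (ln (real (Suc s)) - ln (real s))" using increment[of s] assms by simp
  also have "\<dots> \<le> 2 * (ln (real t) - ln (real s))" using assms by simp
  finally have "1 / real s \<le> 2 * (ln (real t) - ln (real s))" .
  moreover have "(\<Sum>K=s..t. 1 / real K) = 1 / real s + (\<Sum>K=Suc s..t. 1 / real K)"
    using assms by (intro sum.atLeast_Suc_atMost) simp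
  ultimately show ?thesis using tail[of t] assms by simp
qed

lemma mass_le_four: "1 \<le> K \<Longrightarrow> mass (Suc K) \<le> 4 * mass (max s (K - 1))"
  using mass_Suc_le[of K] mass_Suc_le[of "K - 1"] mass_mono[of "K - 1" "max s (K - 1)"] by simp

lemma ln_mass_Suc_ge: "ln (mass n) + 1 / M \<le> ln (mass (Suc n))"
proof -
  have M: "0 < 1 - 1 / real M" using M_ge by simp
  have "ln (mass n) \<le> ln (mass (Suc n) * (1 - 1 / M))"
    using mass_le_Suc[of n] mass_pos[of n] by simp
  also have "\<dots> = ln (mass (Suc n)) + ln (1 - 1 / M)" using M mass_pos[of "Suc n"] by (intro ln_mult_pos)
  also have "\<dots> \<le> ln (mass (Suc n)) - 1 / M" using ln_le_minus_one[OF M] by simp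
  finally show ?thesis by simp
qed

text \<open>
  Each new digit multiplies \<open>mass\<close> by \<open>m\<^sub>n / (m\<^sub>n - 1) \<ge> 1 / (1 - 1 / M)\<close>, whose logarithm is at least \<open>1 / M\<close>.
\<close>

lemma ln_mass_diff_ge: "s \<le> t \<Longrightarrow> ln (mass s) + (real t - real s) / M \<le> ln (mass t)"
proof (induction t rule: dec_induct)
  case (step t)
  then show ?case using ln_mass_Suc_ge[of t] by (simp add: add_divide_distrib diff_divide_distrib)
qed simp

lemma ln_mass_ge: "real n / M \<le> ln (mass n)"
  using ln_mass_diff_ge[of 0 n] by (simp add: mass_0)

lemma ln_mass_le: "ln (mass n) \<le> n"
proof -
  have "mass n \<le> 2 ^ n" by (induction n) (auto simp: mass_0 intro: order.trans[OF mass_Suc_le])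
  then have "ln (mass n) \<le> ln (2 ^ n)" using mass_pos[of n] by simp
  also have "\<dots> \<le> n" using ln_le_minus_one[of "2::real"] by (simp add: ln_realpow mult_left_le)
  finally show ?thesis .
qed


text \<open>
  With \<open>g = ln\<close> each of the \<open>t - s + 1 \<le> 2 (t - s)\<close> scales has energy at most \<open>64 M\<^sup>4\<close>.
\<close>

theorem mother_Res_degree_1:
  assumes st: "0 < s" "s < t"
  shows "ereal ((real t - real s) / (128 * real M ^ 6))
    \<le> mother_Res 1 m (ends0 m \<inter> hatpi -` {0..<2 ^ s}) (ends0 m \<inter> hatpi -` {2 ^ t..})"
proof -
  define h where "h = (real t - real s) / M"
  have M: "0 < real M" using M_ge by simp
  have h: "0 < h" using st M by (simp add: h_def)
  have diff: "h \<le> ln (mass t) - ln (mass s)" using ln_mass_diff_ge[of s t] st by (simp add: h_def)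
  have "ereal ((ln (mass t) - ln (mass s))\<^sup>2 / (128 * real M ^ 4 * (real t - real s)))
    \<le> mother_Res (Suc 0) m (ends0 m \<inter> hatpi -` {0..<2 ^ s}) (ends0 m \<inter> hatpi -` {2 ^ t..})"
  proof (rule mother_Res_ge_of_potential[OF st, where g = ln and L = "\<lambda>K. 4 / mass (Suc K)"])
    fix K a b
    assume K: "s \<le> K" "K \<le> t" and ab: "mass (max s (K - 1)) \<le> a" "mass (max s (K - 1)) \<le> b"
    have "\<bar>ln a - ln b\<bar> \<le> \<bar>a - b\<bar> / (mass (Suc K) / 4)"
      using ab mass_le_four[of K s] K st mass_pos[of "Suc K"] by (intro ln_lipschitz_above) auto
    then show "\<bar>ln a - ln b\<bar> \<le> 4 / mass (Suc K) * \<bar>a - b\<bar>" by (simp add: mult.commute)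
  next
    show "ln (mass s) \<noteq> ln (mass t)" using diff h by simp
    have "(\<Sum>K=s..t. (4 / mass (Suc K))\<^sup>2 * (4 * real M ^ 4 * (1 + real M * Suc K) ^ 0 * (mass (Suc K))\<^sup>2))
        = (\<Sum>K=s..t. 64 * real M ^ 4)"
      using less_imp_neq[OF mass_pos] by (intro sum.cong) (auto simp: power_divide)
    also have "\<dots> = 64 * real M ^ 4 * (real t - real s + 1)" using st by (simp add: of_nat_diff Suc_diff_le)
    also have "\<dots> \<le> 64 * real M ^ 4 * (2 * (real t - real s))" using st by (intro mult_left_mono) auto
    also have "\<dots> = 128 * real M ^ 4 * (real t - real s)" by simp
    finally show "(\<Sum>K=s..t. (4 / mass (Suc K))\<^sup>2 * (4 * real M ^ 4 * (1 + real M * Suc K) ^ 0 * (mass (Suc K))\<^sup>2))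
        \<le> 128 * real M ^ 4 * (real t - real s)" .
  qed
  moreover have "(real t - real s) / (128 * real M ^ 6)
      \<le> (ln (mass t) - ln (mass s))\<^sup>2 / (128 * real M ^ 4 * (real t - real s))"
  proof -
    have "(real t - real s) / (128 * real M ^ 6) = h\<^sup>2 / (128 * real M ^ 4 * (real t - real s))"
      using st M by (simp add: h_def power_divide divide_simps eval_nat_numeral)
    also have "\<dots> \<le> (ln (mass t) - ln (mass s))\<^sup>2 / (128 * real M ^ 4 * (real t - real s))"
      using diff h st M by (intro divide_right_mono power_mono) auto
    finally show ?thesis .
  qed
  ultimately show ?thesis by (simp add: order.trans[rotated])
qed

text \<open>
  The factor \<open>1 + M (K + 1)\<close> in the energy at scale \<open>K\<close> is the cost of the second free digit. A second logarithm
  brings a further \<open>1 / ln (mass K)\<close>, of order \<open>1 / K\<close>, into the Lipschitz constant; its square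
  turns that cost into \<open>1 / K\<close>.
\<close>

theorem mother_Res_degree_2:
  assumes st: "0 < s" "s < t"
  shows "ereal ((ln (real t) - ln (real s)) / (2304 * real M ^ 9))
    \<le> mother_Res 2 m (ends0 m \<inter> hatpi -` {0..<2 ^ s}) (ends0 m \<inter> hatpi -` {2 ^ t..})"
proof -
  define l where "l = ln (real t) - ln (real s)"
  have l: "0 < l" using st by (simp add: l_def)
  have M: "1 \<le> real M" using M_ge by simp
  have ln_pos: "0 < ln (mass n)" if "0 < n" for n
  proof -
    have "0 < real n / M" using that M by simp
    then show ?thesis using ln_mass_ge[of n] by linarith
  qed
  have diff: "l / M \<le> ln (ln (mass t)) - ln (ln (mass s))"
  proof -
    \<comment> \<open>\<open>ln (mass t) / ln (mass s) \<ge> 1 + y / M\<close>, and Bernoulli's inequality moves the factor \<open>1 / M\<close> out of the logarithm\<close>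
    define y where "y = (real t - real s) / real s"
    have y: "0 \<le> y" using st by (simp add: y_def)
    have yM: "0 \<le> y / M" using y by simp
    then have "1 + real M * (y / M) \<le> (1 + y / M) ^ M" by (intro Bernoulli_inequality) linarith
    then have "1 + y \<le> (1 + y / M) ^ M" using M by simp
    then have "ln (1 + y) \<le> ln ((1 + y / M) ^ M)" using y by simp
    also have "\<dots> = M * ln (1 + y / M)" using yM by (intro ln_realpow)
    finally have "ln (1 + y) / M \<le> ln (1 + y / M)" using M by (simp add: divide_le_eq mult.commute)
    moreover have "ln (1 + y) = l"
    proof -
      have "1 + y = real t / real s" using st by (simp add: y_def field_simps)
      then show ?thesis using st by (simp add: l_def ln_div)
    qed
    moreover have "ln (1 + y / M) \<le> ln (ln (mass t) / ln (mass s))"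
    proof -
      have "ln (mass s) * (y / M) \<le> real s * (y / M)"
        using y M ln_mass_le[of s] by (intro mult_right_mono) auto
      also have "\<dots> = (real t - real s) / M" using st by (simp add: y_def)
      also have "\<dots> \<le> ln (mass t) - ln (mass s)" using ln_mass_diff_ge[of s t] st by simp
      finally have "1 + y / M \<le> ln (mass t) / ln (mass s)"
        using ln_pos[OF st(1)] by (simp add: field_simps)
      moreover have "0 < 1 + y / M" using yM by linarith
      ultimately show ?thesis by simp
    qed
    moreover have "ln (ln (mass t) / ln (mass s)) = ln (ln (mass t)) - ln (ln (mass s))"
      using ln_pos[of s] ln_pos[of t] st by (simp add: ln_div)
    ultimately show ?thesis by simp
  qed
  have "ereal ((ln (ln (mass t)) - ln (ln (mass s)))\<^sup>2 / (2304 * real M ^ 7 * l))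
    \<le> mother_Res (Suc 1) m (ends0 m \<inter> hatpi -` {0..<2 ^ s}) (ends0 m \<inter> hatpi -` {2 ^ t..})"
  proof (rule mother_Res_ge_of_potential[OF st,
        where g = "\<lambda>a. ln (ln a)" and L = "\<lambda>K. (4 / mass (Suc K)) * (2 * M / K)"])
    fix K a b
    let ?n = "max s (K - 1)"
    assume K: "s \<le> K" "K \<le> t" and ab: "mass ?n \<le> a" "mass ?n \<le> b"
    have K0: "0 < real K" using K st by simp
    have n: "real K / (2 * M) \<le> ln (mass ?n)"
    proof -
      have "K \<le> 2 * ?n" using st K by (auto simp: max_def)
      then have "real K / 2 \<le> real ?n" by linarith
      then have "real K / 2 / M \<le> real ?n / M" using M by (intro divide_right_mono) auto
      then show ?thesis using ln_mass_ge[of ?n] by simp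
    qed
    have "\<bar>ln a - ln b\<bar> \<le> \<bar>a - b\<bar> / (mass (Suc K) / 4)"
      using ab mass_le_four[of K s] K st mass_pos[of "Suc K"] by (intro ln_lipschitz_above) auto
    then have 1: "\<bar>ln a - ln b\<bar> \<le> (4 / mass (Suc K)) * \<bar>a - b\<bar>" by (simp add: mult.commute)
    have "ln (mass ?n) \<le> ln a" "ln (mass ?n) \<le> ln b" using ab mass_pos[of ?n] by auto
    then have "\<bar>ln (ln a) - ln (ln b)\<bar> \<le> \<bar>ln a - ln b\<bar> / (real K / (2 * M))"
      using n K0 M by (intro ln_lipschitz_above) auto
    also have "\<dots> = (2 * M / K) * \<bar>ln a - ln b\<bar>" by simp
    also have "\<dots> \<le> (2 * M / K) * ((4 / mass (Suc K)) * \<bar>a - b\<bar>)"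
      by (rule mult_left_mono[OF 1]) simp
    finally show "\<bar>ln (ln a) - ln (ln b)\<bar> \<le> (4 / mass (Suc K)) * (2 * M / K) * \<bar>a - b\<bar>"
      by (simp only: mult_ac)
  next
    have "0 < l / M" using l M by simp
    then show "ln (ln (mass s)) \<noteq> ln (ln (mass t))" using diff by linarith
    have "(\<Sum>K=s..t. ((4 / mass (Suc K)) * (2 * M / K))\<^sup>2
          * (4 * real M ^ 4 * (1 + real M * Suc K) ^ 1 * (mass (Suc K))\<^sup>2))
        \<le> (\<Sum>K=s..t. 768 * real M ^ 7 * (1 / real K))"
    proof (intro sum_mono)
      fix K assume "K \<in> {s..t}"
      then have K: "1 \<le> real K" using st by simp
      have "real M \<le> real M * real K" using mult_left_mono[OF K, of "real M"] by simp
      then have "1 \<le> real M * real K" "real M \<le> real M * real K" using M by linarith+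
      then have "1 + real M * Suc K \<le> 3 * real M * real K" by (simp add: algebra_simps)
      then have "256 * real M ^ 6 / (real K)\<^sup>2 * (1 + real M * Suc K)
          \<le> 256 * real M ^ 6 / (real K)\<^sup>2 * (3 * real M * real K)" by (intro mult_left_mono) auto
      also have "\<dots> = 768 * real M ^ 7 * (1 / real K)"
        using K by (simp add: field_simps eval_nat_numeral)
      moreover have cancel: "((4 / p) * (2 * r / q))\<^sup>2 * (4 * r ^ 4 * z ^ 1 * p\<^sup>2) = 256 * r ^ 6 / q\<^sup>2 * z"
        if "0 < p" "0 < q" for p q r z :: real
        using that by (simp add: power2_eq_square) (simp add: eval_nat_numeral)
      ultimately show "((4 / mass (Suc K)) * (2 * M / K))\<^sup>2
          * (4 * real M ^ 4 * (1 + real M * Suc K) ^ 1 * (mass (Suc K))\<^sup>2)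
          \<le> 768 * real M ^ 7 * (1 / real K)"
        using cancel[of "mass (Suc K)" "real K" M "1 + real M * Suc K"] mass_pos[of "Suc K"] K by simp
    qed
    also have "\<dots> = 768 * real M ^ 7 * (\<Sum>K=s..t. 1 / real K)" by (simp only: sum_distrib_left)
    also have "\<dots> \<le> 768 * real M ^ 7 * (3 * l)"
      unfolding l_def by (intro mult_left_mono sum_inverse_le_ln st) simp
    finally show "(\<Sum>K=s..t. ((4 / mass (Suc K)) * (2 * M / K))\<^sup>2
          * (4 * real M ^ 4 * (1 + real M * Suc K) ^ 1 * (mass (Suc K))\<^sup>2))
        \<le> 2304 * real M ^ 7 * l" by simp
  qed
  moreover have "l / (2304 * real M ^ 9)
      \<le> (ln (ln (mass t)) - ln (ln (mass s)))\<^sup>2 / (2304 * real M ^ 7 * l)"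
  proof -
    have "l / (2304 * real M ^ 9) = (l / M)\<^sup>2 / (2304 * real M ^ 7 * l)"
      using l M by (simp add: power_divide divide_simps eval_nat_numeral)
    also have "\<dots> \<le> (ln (ln (mass t)) - ln (ln (mass s)))\<^sup>2 / (2304 * real M ^ 7 * l)"
      using diff l M by (intro divide_right_mono power_mono) auto
    finally show ?thesis .
  qed
  ultimately show ?thesis by (simp add: l_def numeral_2_eq_2 order.trans[rotated])
qed

end

theorem theorem1p6:
  fixes M :: nat
  shows "\<exists>C::real. C > 0 \<and>
    (\<forall>m::nat \<Rightarrow> nat. (\<forall>i. m i \<ge> 2) \<and> bdd_above (range m) \<and> (SUP i. m i) = M \<longrightarrow>
      (\<forall>s t::nat. 0 < s \<and> s < t \<longrightarrow>
         mother_Res 1 m (ends0 m \<inter> hatpi -` {0..<2 ^ s}) (ends0 m \<inter> hatpi -` {2 ^ t..})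
           \<ge> ereal (C * (real t - real s)) \<and>
         mother_Res 2 m (ends0 m \<inter> hatpi -` {0..<2 ^ s}) (ends0 m \<inter> hatpi -` {2 ^ t..})
           \<ge> ereal (C * (ln (real t) - ln (real s)))))"
proof (intro exI[of _ "1 / (2304 * real (max 2 M) ^ 9)"] conjI allI impI)
  show "0 < 1 / (2304 * real (max 2 M) ^ 9)" by simp
  fix m :: "nat \<Rightarrow> nat" and s t :: nat
  assume m: "(\<forall>i. m i \<ge> 2) \<and> bdd_above (range m) \<and> (SUP i. m i) = M" and st: "0 < s \<and> s < t"
  \<comment> \<open>a positive constant is required for \<open>M < 2\<close> too, although no sequence then has supremum \<open>M\<close>; hence \<open>max 2 M\<close>\<close>
  interpret bounded_digits m "max 2 M"
  proof
    show "2 \<le> m i" for i using m by blast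
    have "m i \<le> M" for i using m cSUP_upper[of i UNIV m] by simp
    then show "m i \<le> max 2 M" for i using max.coboundedI2 by blast
  qed
  have "real (max 2 M) ^ 6 \<le> real (max 2 M) ^ 9" by (intro power_increasing) auto
  then have "(real t - real s) / (2304 * real (max 2 M) ^ 9) \<le> (real t - real s) / (128 * real (max 2 M) ^ 6)"
    using st by (intro divide_left_mono mult_mono) auto
  then show "ereal (1 / (2304 * real (max 2 M) ^ 9) * (real t - real s))
      \<le> mother_Res 1 m (ends0 m \<inter> hatpi -` {0..<2 ^ s}) (ends0 m \<inter> hatpi -` {2 ^ t..})"
    using mother_Res_degree_1[of s t] st by (simp add: order.trans[rotated])
  show "ereal (1 / (2304 * real (max 2 M) ^ 9) * (ln (real t) - ln (real s)))
      \<le> mother_Res 2 m (ends0 m \<inter> hatpi -` {0..<2 ^ s}) (ends0 m \<inter> hatpi -` {2 ^ t..})"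
    using mother_Res_degree_2[of s t] st by simp
qed

end
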